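(* Consider the discrete-time switched linear control system $x(t+1)=A_{\sigma(t)}x(t)+B_{\sigma(t)}u(t)$ with $A_1,\dots,A_M\in\mathbb{R}^{n\times n}$, $B_1,\dots,B_M\in\mathbb{R}^{n\times m}$, and let $\rho_*^I$ (respectively, $\rho_*^D$) be its minimal growth rate under mode-independent (respectively, mode-dependent) feedback control. Then, in the mode-independent case (respectively, in the mode-dependent case), there exist a mode-independent (respectively, mode-dependent) change of feedback and a change of coordinates under which the system admits the representation $$z(t+1)=\begin{pmatrix}A^{yy}_{\sigma(t)}&A^{y\xi}_{\sigma(t)}\\ \mathbf{0}&A^{\xi\xi}_{\sigma(t)}\end{pmatrix}z(t)+\begin{pmatrix}B^y_{\sigma(t)}\\ B^\xi_{\sigma(t)}\end{pmatrix}v(t),\qquad z=\begin{pmatrix}y\\ \xi\end{pmatrix},\ y\in\mathbb{R}^{n_p},\ \xi\in\mathbb{R}^{n-n_p},$$ for some $n_p\in\{0,\dots,n\}$, such that the following hold: 1. The autonomous $y$-subsystem $y(t+1)=A^{yy}_{\sigma(t)}y(t)$ is fixed-time stable, i.e., there exists $T\in\mathbb{N}$ such that for all $y(0)\in\mathbb{R}^{n_p}$ and all $\sigma\in\mathcal{S}$, $y(t)=0$ for all $t\ge T$. 2. The $\xi$-subsystem $\xi(t+1)=A^{\xi\xi}_{\sigma(t)}\xi(t)+B^\xi_{\sigma(t)}v(t)$ admits no non-trivial mode-independently (respectively, mode-dependently) fixed-time stabilizable subspaces. Furthermore, its minimal growth rate under mode-independent (respectively, mode-dependent) feedback, denoted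 $\rho_*^{I,\xi}$ (respectively, $\rho_*^{D,\xi}$), equals that of the original system: $\rho_*^{I,\xi}=\rho_*^I$ (respectively, $\rho_*^{D,\xi}=\rho_*^D$).
   Context: Notation: $\mathcal{M}=\{1,\dots,M\}$; $\mathbb{N}$ includes $0$; $\mathcal{S}$ is the set of all switching signals $\sigma:\mathbb{N}\to\mathcal{M}$; $\|\cdot\|$ is the Euclidean norm. Growth rates. For a switched control system $x(t+1)=A_{\sigma(t)}x(t)+B_{\sigma(t)}u(t)$ with state in $\mathbb{R}^n$ and input in $\mathbb{R}^m$: a constant $\rho\in[0,\infty)$ is an attainable growth rate by mode-dependent feedback if there exist functions $\varphi_1,\dots,\varphi_M:\mathbb{R}^n\to\mathbb{R}^m$ and $C>0$ such that every solution of $x(t+1)=A_{\sigma(t)}x(t)+B_{\sigma(t)}\varphi_{\sigma(t)}(x(t))$ satisfies $\|x(t)\|\le C\rho^t\|x(0)\|$ for all $t\in\mathbb{N}$, $x(0)\in\mathbb{R}^n$, $\sigma\in\mathcal{S}$. It is attainable by mode-independent feedback if the same holds with a single function $\varphi_1=\dots=\varphi_M=\varphi$. The minimal growth rate $\rho_*^D$ (respectively, $\rho_*^I$) is the infimum of all growth rates attainable by mode-dependent (respectively, mode-independent) feedback. The functions $\varphi_j,\varphi$ are arbitrary (not necessarily linear). The same definitions apply to the $\xi$-subsystem with input $v$. A change of coordinates is $z=Px$ with $P\in\mathbb{R}^{n\times n}$ invertible. A mode-independent change of feedback is $u(t)=Kx(t)+v(t)$ with $K\in\mathbb{R}^{m\times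 n}$; a mode-dependent change of feedback is $u(t)=K_{\sigma(t)}x(t)+v(t)$ with $K_1,\dots,K_M\in\mathbb{R}^{m\times n}$; $v(t)\in\mathbb{R}^m$ is the new input. A subspace $V$ of the state space is mode-dependently fixed-time stabilizable if there exist feedback functions $\varphi_1,\dots,\varphi_M$ and $T\in\mathbb{N}$ such that, for every initial condition in $V$ and every $\sigma\in\mathcal{S}$, the closed-loop solution is $0$ for all $t\ge T$; it is mode-independently fixed-time stabilizable if this holds with a single $\varphi_1=\dots=\varphi_M=\varphi$. Non-trivial means $V\ne\{0\}$. *)

theory Defs
  imports Complex_Main "Jordan_Normal_Form.VS_Connect"
begin

text \<open>
  The state dimension of the subsystems varies inside the statement, so vectors and matrices are
  those of Jordan_Normal_Form, whose dimensions are natural numbers.  Dimension 0 is allowed.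
  A family indexed by the modes is a function on \<^typ>\<open>nat\<close> of which only the values on
  \<open>{1..M}\<close> matter.
\<close>

definition euclid_norm :: "real vec \<Rightarrow> real" where
  "euclid_norm x = sqrt (x \<bullet> x)"

definition signals :: "nat \<Rightarrow> (nat \<Rightarrow> nat) set" where
  "signals M = {\<sigma>. \<forall>t. \<sigma> t \<in> {1..M}}"

definition switched_system ::
    "nat \<Rightarrow> nat \<Rightarrow> nat \<Rightarrow> (nat \<Rightarrow> real mat) \<Rightarrow> (nat \<Rightarrow> real mat) \<Rightarrow> bool" where
  "switched_system M n m A B \<longleftrightarrow>
     (\<forall>j\<in>{1..M}. A j \<in> carrier_mat n n \<and> B j \<in> carrier_mat n m)"

definition trajectory ::
    "nat \<Rightarrow> nat \<Rightarrow> (nat \<Rightarrow> real mat) \<Rightarrow> (nat \<Rightarrow> real mat) \<Rightarrow> (nat \<Rightarrow> nat)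
     \<Rightarrow> (nat \<Rightarrow> real vec) \<Rightarrow> (nat \<Rightarrow> real vec) \<Rightarrow> bool" where
  "trajectory n m A B \<sigma> x u \<longleftrightarrow>
     (\<forall>t. x t \<in> carrier_vec n \<and> u t \<in> carrier_vec m \<and>
          x (Suc t) = A (\<sigma> t) *\<^sub>v x t + B (\<sigma> t) *\<^sub>v u t)"

datatype feedback_kind = Mode_Independent | Mode_Dependent

text \<open>Used both for nonlinear feedback laws and for the gains \<open>K\<close> of a change of feedback.\<close>

fun admissible_family :: "feedback_kind \<Rightarrow> nat \<Rightarrow> (nat \<Rightarrow> 'a) \<Rightarrow> bool" where
  "admissible_family Mode_Independent M f \<longleftrightarrow> (\<exists>g. \<forall>j\<in>{1..M}. f j = g)"
| "admissible_family Mode_Dependent M f \<longleftrightarrow> True"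

definition feedback_laws ::
    "feedback_kind \<Rightarrow> nat \<Rightarrow> nat \<Rightarrow> nat \<Rightarrow> (nat \<Rightarrow> real vec \<Rightarrow> real vec) set" where
  "feedback_laws k M n m =
     {\<phi>. (\<forall>j\<in>{1..M}. \<phi> j \<in> carrier_vec n \<rightarrow> carrier_vec m) \<and> admissible_family k M \<phi>}"

definition closed_loop ::
    "nat \<Rightarrow> nat \<Rightarrow> (nat \<Rightarrow> real mat) \<Rightarrow> (nat \<Rightarrow> real mat) \<Rightarrow> (nat \<Rightarrow> real vec \<Rightarrow> real vec)
     \<Rightarrow> (nat \<Rightarrow> nat) \<Rightarrow> (nat \<Rightarrow> real vec) \<Rightarrow> bool" where
  "closed_loop n m A B \<phi> \<sigma> x \<longleftrightarrow> trajectory n m A B \<sigma> x (\<lambda>t. \<phi> (\<sigma> t) (x t))"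

definition attainable_rate ::
    "feedback_kind \<Rightarrow> nat \<Rightarrow> nat \<Rightarrow> nat \<Rightarrow> (nat \<Rightarrow> real mat) \<Rightarrow> (nat \<Rightarrow> real mat)
     \<Rightarrow> real \<Rightarrow> bool" where
  "attainable_rate k M n m A B \<rho> \<longleftrightarrow>
     0 \<le> \<rho> \<and>
     (\<exists>\<phi>\<in>feedback_laws k M n m. \<exists>C>0. \<forall>\<sigma>\<in>signals M. \<forall>x.
        closed_loop n m A B \<phi> \<sigma> x \<longrightarrow>
        (\<forall>t. euclid_norm (x t) \<le> C * \<rho> ^ t * euclid_norm (x 0)))"

text \<open>
  The infimum is over a set bounded below by 0 and never empty, since the zero feedback attains
  the maximal operator norm of the matrices \<open>A j\<close>.
\<close>

definition minimal_growth_rate ::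
    "feedback_kind \<Rightarrow> nat \<Rightarrow> nat \<Rightarrow> nat \<Rightarrow> (nat \<Rightarrow> real mat) \<Rightarrow> (nat \<Rightarrow> real mat) \<Rightarrow> real" where
  "minimal_growth_rate k M n m A B = Inf {\<rho>. attainable_rate k M n m A B \<rho>}"

definition fixed_time_stabilizable ::
    "feedback_kind \<Rightarrow> nat \<Rightarrow> nat \<Rightarrow> nat \<Rightarrow> (nat \<Rightarrow> real mat) \<Rightarrow> (nat \<Rightarrow> real mat)
     \<Rightarrow> real vec set \<Rightarrow> bool" where
  "fixed_time_stabilizable k M n m A B V \<longleftrightarrow>
     (\<exists>\<phi>\<in>feedback_laws k M n m. \<exists>T. \<forall>\<sigma>\<in>signals M. \<forall>x.
        closed_loop n m A B \<phi> \<sigma> x \<and> x 0 \<in> V \<longrightarrow> (\<forall>t\<ge>T. x t = 0\<^sub>v n))"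

definition fixed_time_stable :: "nat \<Rightarrow> nat \<Rightarrow> (nat \<Rightarrow> real mat) \<Rightarrow> bool" where
  "fixed_time_stable M n A \<longleftrightarrow>
     (\<exists>T. \<forall>\<sigma>\<in>signals M. \<forall>y.
        (\<forall>t. y t \<in> carrier_vec n \<and> y (Suc t) = A (\<sigma> t) *\<^sub>v y t) \<longrightarrow> (\<forall>t\<ge>T. y t = 0\<^sub>v n))"

text \<open>
  Under \<open>z = P x\<close> and \<open>u = K\<^sub>\<sigma> x + v\<close>, the system \<open>(A, B)\<close> with input \<open>u\<close> becomes
  the system \<open>(A', B')\<close> with input \<open>v\<close>.
\<close>

definition admits_representation ::
    "nat \<Rightarrow> nat \<Rightarrow> nat \<Rightarrow> (nat \<Rightarrow> real mat) \<Rightarrow> (nat \<Rightarrow> real mat) \<Rightarrow> real mat \<Rightarrow> (nat \<Rightarrow> real mat)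
     \<Rightarrow> (nat \<Rightarrow> real mat) \<Rightarrow> (nat \<Rightarrow> real mat) \<Rightarrow> bool" where
  "admits_representation M n m A B P K A' B' \<longleftrightarrow>
     (\<forall>\<sigma>\<in>signals M. \<forall>x v.
        (\<forall>t. x t \<in> carrier_vec n \<and> v t \<in> carrier_vec m) \<longrightarrow>
        (trajectory n m A B \<sigma> x (\<lambda>t. K (\<sigma> t) *\<^sub>v x t + v t) \<longleftrightarrow>
         trajectory n m A' B' \<sigma> (\<lambda>t. P *\<^sub>v x t) v))"

end

theory Submission
  imports "HOL-Analysis.L2_Norm" Defs
begin

text \<open>
  Call a state \<open>x\<close> null if some admissible choice of inputs steers it to 0 in one step under every
  mode.  If there is a non-zero null state, a feedback realizing these inputs along \<open>x\<close> together with
  a change of basis containing \<open>x\<close> splits off a one-dimensional autonomous part, and one continues with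
  the quotient.  After a maximal number of such steps the autonomous part is strictly upper
  triangular, hence nilpotent uniformly in the switching signal, and the remaining \<open>\<xi>\<close>-subsystem has
  no non-zero null state; then every feedback can be countered by a switching signal that keeps a
  non-zero trajectory away from 0.

  For the growth rates, a feedback of the full system of rate \<open>\<rho>\<close> gives, for each \<open>\<xi>\<close>, the infimum
  over the states above \<open>\<xi>\<close> of the smallest \<open>b\<close> with \<open>\<parallel>x(t)\<parallel> \<le> b \<rho>\<^sup>t\<close>; acting as if the state were a
  near-minimizer makes this a Lyapunov function of the \<open>\<xi>\<close>-subsystem with rate arbitrarily close
  to \<open>\<rho>\<close>.  Conversely, a feedback of the \<open>\<xi>\<close>-subsystem may be taken of linear growth, and then
  drives the nilpotent part at the same rate.
\<close>

subsection \<open>Norm estimates\<close>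

text \<open>Identifying the norm with \<open>L2_set\<close> gives access to the triangle inequality
  and the componentwise estimates of the library.\<close>

lemma euclid_norm_L2_set: "euclid_norm x = L2_set (\<lambda>i. x $ i) {0..<dim_vec x}"
  by (simp add: euclid_norm_def L2_set_def scalar_prod_def power2_eq_square)

lemma euclid_norm_nonneg [simp]: "0 \<le> euclid_norm x"
  by (simp add: euclid_norm_L2_set)

lemma euclid_norm_index_le: "i < dim_vec x \<Longrightarrow> \<bar>x $ i\<bar> \<le> euclid_norm x"
  using member_le_L2_set[of "{0..<dim_vec x}" i "\<lambda>i. \<bar>x $ i\<bar>"]
  by (simp add: euclid_norm_L2_set L2_set_def)

lemma euclid_norm_le_sum: "euclid_norm x \<le> (\<Sum>i<dim_vec x. \<bar>x $ i\<bar>)"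
  using L2_set_le_sum_abs[of "\<lambda>i. x $ i" "{0..<dim_vec x}"]
  by (simp add: euclid_norm_L2_set atLeast0LessThan)

lemma euclid_norm_zero [simp]: "euclid_norm (0\<^sub>v n) = 0"
  by (simp add: euclid_norm_def)

lemma euclid_norm_triangle:
  assumes "x \<in> carrier_vec n" "y \<in> carrier_vec n"
  shows "euclid_norm (x + y) \<le> euclid_norm x + euclid_norm y"
proof -
  have "euclid_norm (x + y) = L2_set (\<lambda>i. x $ i + y $ i) {0..<n}"
    using assms by (auto simp: euclid_norm_L2_set intro!: L2_set_cong)
  then show ?thesis
    using L2_set_triangle_ineq[of "\<lambda>i. x $ i" "\<lambda>i. y $ i" "{0..<n}"] assms
    by (simp add: euclid_norm_L2_set)
qed

lemma euclid_norm_uminus: "euclid_norm (- x) = euclid_norm (x :: real vec)"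
  by (simp add: euclid_norm_L2_set L2_set_def)

lemma euclid_norm_smult: "euclid_norm (c \<cdot>\<^sub>v x) = \<bar>c\<bar> * euclid_norm x"
  by (simp add: euclid_norm_def real_sqrt_mult)

text \<open>The sum of the absolute values of the entries is a crude operator bound; growth rates
  only ask for the existence of some constant.\<close>

lemma euclid_norm_mult_mat_vec_bound:
  obtains c where "0 < c"
    "\<And>x. x \<in> carrier_vec (dim_col A) \<Longrightarrow> euclid_norm (A *\<^sub>v x) \<le> c * euclid_norm x"
proof
  \<comment> \<open>The summand 1 keeps the constant positive for a zero or empty matrix.\<close>
  let ?c = "1 + (\<Sum>i<dim_row A. \<Sum>l<dim_col A. \<bar>A $$ (i, l)\<bar>)"
  show "0 < ?c" by (smt (verit) sum_nonneg abs_ge_zero)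
  fix x :: "real vec" assume x: "x \<in> carrier_vec (dim_col A)"
  have "euclid_norm (A *\<^sub>v x) \<le> (\<Sum>i<dim_row A. \<bar>(A *\<^sub>v x) $ i\<bar>)"
    using euclid_norm_le_sum[of "A *\<^sub>v x"] by simp
  also have "\<dots> \<le> (\<Sum>i<dim_row A. \<Sum>l<dim_col A. \<bar>A $$ (i, l)\<bar> * euclid_norm x)"
  proof (intro sum_mono)
    fix i assume "i \<in> {..<dim_row A}"
    then have "\<bar>(A *\<^sub>v x) $ i\<bar> = \<bar>\<Sum>l<dim_col A. A $$ (i, l) * x $ l\<bar>"
      using x by (simp add: scalar_prod_def atLeast0LessThan)
    also have "\<dots> \<le> (\<Sum>l<dim_col A. \<bar>A $$ (i, l) * x $ l\<bar>)" by (rule sum_abs)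
    also have "\<dots> \<le> (\<Sum>l<dim_col A. \<bar>A $$ (i, l)\<bar> * euclid_norm x)"
      using x by (intro sum_mono) (auto simp: abs_mult intro!: mult_left_mono euclid_norm_index_le)
    finally show "\<bar>(A *\<^sub>v x) $ i\<bar> \<le> (\<Sum>l<dim_col A. \<bar>A $$ (i, l)\<bar> * euclid_norm x)" .
  qed
  also have "\<dots> \<le> ?c * euclid_norm x"
    unfolding sum_distrib_right[symmetric] distrib_right by simp
  finally show "euclid_norm (A *\<^sub>v x) \<le> ?c * euclid_norm x" .
qed

lemma euclid_norm_mult_mat_vec_bound_family:
  assumes "finite J" "\<And>j. j \<in> J \<Longrightarrow> dim_col (A j) = n"
  obtains c where "0 < c"
    "\<And>j x. j \<in> J \<Longrightarrow> x \<in> carrier_vec n \<Longrightarrow> euclid_norm (A j *\<^sub>v x) \<le> c * euclid_norm x"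
proof -
  have "\<exists>c>0. \<forall>j\<in>J. \<forall>x\<in>carrier_vec n. euclid_norm (A j *\<^sub>v x) \<le> c * euclid_norm x"
    using assms
  proof (induction J)
    case empty
    then show ?case by (intro exI[of _ 1]) auto
  next
    case (insert j J)
    then obtain c where c: "c > 0"
      "\<And>i x. i \<in> J \<Longrightarrow> x \<in> carrier_vec n \<Longrightarrow> euclid_norm (A i *\<^sub>v x) \<le> c * euclid_norm x"
      by auto
    obtain d where d: "d > 0"
      "\<And>x. x \<in> carrier_vec n \<Longrightarrow> euclid_norm (A j *\<^sub>v x) \<le> d * euclid_norm x"
      using euclid_norm_mult_mat_vec_bound[of "A j"] insert.prems by auto
    have "euclid_norm (A i *\<^sub>v x) \<le> (c + d) * euclid_norm x"
      if "i \<in> insert j J" "x \<in> carrier_vec n" for i x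
    proof -
      have "c * euclid_norm x \<ge> 0" "d * euclid_norm x \<ge> 0" using c d by simp_all
      then show ?thesis using that c(2)[of i x] d(2)[of x] by (auto simp: distrib_right)
    qed
    then show ?case using c d by (intro exI[of _ "c + d"]) auto
  qed
  then show ?thesis using that by blast
qed

text \<open>A new functional is either determined by the previous ones, or its value can be corrected
  along a vector in their common kernel.\<close>

lemma bounded_preimage_functionals:
  assumes "finite R" "R \<subseteq> carrier_vec m"
  shows "\<exists>c\<ge>0. \<forall>u\<in>carrier_vec m. \<exists>u'\<in>carrier_vec m.
    (\<forall>r\<in>R. r \<bullet> u' = r \<bullet> u) \<and> euclid_norm u' \<le> c * (\<Sum>r\<in>R. \<bar>r \<bullet> u\<bar>)"
  using assms
proof (induction R)
  case empty
  then show ?case by (intro exI[of _ 0]) (auto intro!: bexI[of _ "0\<^sub>v m"])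
next
  case (insert s R)
  then obtain c where c: "c \<ge> 0" and c': "\<And>u. u \<in> carrier_vec m \<Longrightarrow> \<exists>u'\<in>carrier_vec m.
      (\<forall>r\<in>R. r \<bullet> u' = r \<bullet> u) \<and> euclid_norm u' \<le> c * (\<Sum>r\<in>R. \<bar>r \<bullet> u\<bar>)" by auto
  have s: "s \<in> carrier_vec m" and R: "\<And>r. r \<in> R \<Longrightarrow> r \<in> carrier_vec m" using insert.prems by auto
  show ?case
  proof (cases "\<exists>v\<in>carrier_vec m. (\<forall>r\<in>R. r \<bullet> v = 0) \<and> s \<bullet> v \<noteq> 0")
    case False
    have "\<exists>u'\<in>carrier_vec m. (\<forall>r\<in>insert s R. r \<bullet> u' = r \<bullet> u) \<and>
        euclid_norm u' \<le> c * (\<Sum>r\<in>insert s R. \<bar>r \<bullet> u\<bar>)" if u: "u \<in> carrier_vec m" for u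
    proof -
      obtain u' where u': "u' \<in> carrier_vec m" "\<forall>r\<in>R. r \<bullet> u' = r \<bullet> u"
        "euclid_norm u' \<le> c * (\<Sum>r\<in>R. \<bar>r \<bullet> u\<bar>)" using c' u by blast
      \<comment> \<open>\<open>u' - u\<close> lies in the common kernel of \<open>R\<close>, where
        in this case \<open>s\<close> vanishes as well.\<close>
      have "r \<bullet> (u' - u) = 0" if "r \<in> R" for r
        using u'(2) that scalar_prod_minus_distrib[OF R[OF that] u'(1) u] by simp
      moreover have "u' - u \<in> carrier_vec m" using u u' by simp
      ultimately have "s \<bullet> (u' - u) = 0" using False by blast
      then have "s \<bullet> u' = s \<bullet> u" using u u' s by (simp add: scalar_prod_minus_distrib[of _ m])
      moreover have "0 \<le> c * \<bar>s \<bullet> u\<bar>" using c by simp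
      ultimately show ?thesis using u' insert.hyps
        by (intro bexI[of _ u']) (auto simp: distrib_left)
    qed
    then show ?thesis using c by blast
  next
    case True
    then obtain v0 where v0: "v0 \<in> carrier_vec m" "\<And>r. r \<in> R \<Longrightarrow> r \<bullet> v0 = 0" "s \<bullet> v0 \<noteq> 0" by blast
    \<comment> \<open>After normalization, adding \<open>a\<close> times \<open>v\<close> shifts the
      value of \<open>s\<close> by exactly \<open>a\<close> and leaves the values of
      \<open>R\<close> alone.\<close>
    define v where "v = (1 / (s \<bullet> v0)) \<cdot>\<^sub>v v0"
    have v: "v \<in> carrier_vec m" "\<And>r. r \<in> R \<Longrightarrow> r \<bullet> v = 0" "s \<bullet> v = 1"
      using v0 R s by (auto simp: v_def)
    obtain b where b: "b > 0" "\<And>x. x \<in> carrier_vec m \<Longrightarrow> \<bar>s \<bullet> x\<bar> \<le> b * euclid_norm x"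
    proof -
      \<comment> \<open>The functional is read as a matrix with one row, so that the operator bound
        applies.\<close>
      obtain b where b: "b > 0" "\<And>x. x \<in> carrier_vec m \<Longrightarrow>
          euclid_norm (mat_of_rows m [s] *\<^sub>v x) \<le> b * euclid_norm x"
        using euclid_norm_mult_mat_vec_bound[of "mat_of_rows m [s]"] by auto
      have "\<bar>s \<bullet> x\<bar> \<le> b * euclid_norm x" if "x \<in> carrier_vec m" for x
        using euclid_norm_index_le[of 0 "mat_of_rows m [s] *\<^sub>v x"] b(2)[OF that] s by simp
      then show ?thesis using b that by blast
    qed
    define N where "N = euclid_norm v"
    have N: "N \<ge> 0" by (simp add: N_def)
    \<comment> \<open>The summands account for the size \<open>c * S\<close> of \<open>u'\<close>,
      for the wanted value \<open>s \<bullet> u\<close> times \<open>N\<close>, and for the value of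
      \<open>s\<close> at \<open>u'\<close>, at most \<open>b * (c * S)\<close>, times
      \<open>N\<close>.\<close>
    let ?c = "c + N + b * c * N"
    have "\<exists>u'\<in>carrier_vec m. (\<forall>r\<in>insert s R. r \<bullet> u' = r \<bullet> u) \<and>
        euclid_norm u' \<le> ?c * (\<Sum>r\<in>insert s R. \<bar>r \<bullet> u\<bar>)" if u: "u \<in> carrier_vec m" for u
    proof -
      define S where "S = (\<Sum>r\<in>R. \<bar>r \<bullet> u\<bar>)"
      have S: "S \<ge> 0" by (simp add: S_def sum_nonneg)
      obtain u' where u': "u' \<in> carrier_vec m" "\<forall>r\<in>R. r \<bullet> u' = r \<bullet> u"
        "euclid_norm u' \<le> c * S" using c' u unfolding S_def by blast
      define a where "a = s \<bullet> u - s \<bullet> u'"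
      let ?u = "u' + a \<cdot>\<^sub>v v"
      have eqs: "\<forall>r\<in>insert s R. r \<bullet> ?u = r \<bullet> u"
        using u' v R s by (auto simp: scalar_prod_add_distrib[of _ m] a_def)
      have "\<bar>a\<bar> \<le> \<bar>s \<bullet> u\<bar> + b * (c * S)"
        using b(2)[OF u'(1)] mult_left_mono[OF u'(3), of b] b(1) unfolding a_def by linarith
      then have "\<bar>a\<bar> * N \<le> (\<bar>s \<bullet> u\<bar> + b * (c * S)) * N" using N by (rule mult_right_mono)
      moreover have "euclid_norm ?u \<le> euclid_norm u' + \<bar>a\<bar> * N"
        using euclid_norm_triangle[of u' m "a \<cdot>\<^sub>v v"] u' v by (simp add: euclid_norm_smult N_def)
      ultimately have "euclid_norm ?u \<le> c * S + (\<bar>s \<bullet> u\<bar> + b * (c * S)) * N" using u' by linarith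
      moreover have "0 \<le> c * \<bar>s \<bullet> u\<bar>" "0 \<le> N * S" "0 \<le> b * c * N * \<bar>s \<bullet> u\<bar>"
        using b c N S by simp_all
      ultimately have "euclid_norm ?u \<le> ?c * (\<bar>s \<bullet> u\<bar> + S)" by (simp add: algebra_simps)
      then show ?thesis using eqs u' v insert.hyps unfolding S_def
        by (intro bexI[of _ ?u]) auto
    qed
    moreover have "?c \<ge> 0" using b c N by simp
    ultimately show ?thesis by blast
  qed
qed

text \<open>The rows of all \<open>B j\<close> form one finite set of functionals, so a single
  \<open>u'\<close> serves all of \<open>J\<close>, as a mode-independent law requires. Each row
  value is a coordinate of some \<open>B j *\<^sub>v u\<close>, hence bounded by any such
  \<open>b\<close>.\<close>

lemma bounded_preimage_mats:
  assumes "finite J" "\<And>j. j \<in> J \<Longrightarrow> B j \<in> carrier_mat r m"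
  shows "\<exists>c\<ge>0. \<forall>u\<in>carrier_vec m. \<exists>u'\<in>carrier_vec m.
    (\<forall>j\<in>J. B j *\<^sub>v u' = B j *\<^sub>v u) \<and>
    (\<forall>b\<ge>0. (\<forall>j\<in>J. euclid_norm (B j *\<^sub>v u) \<le> b) \<longrightarrow> euclid_norm u' \<le> c * b)"
proof -
  let ?R = "(\<lambda>(j, i). row (B j) i) ` (J \<times> {..<r})"
  have fin: "finite ?R" using assms(1) by simp
  have "?R \<subseteq> carrier_vec m" using assms(2) by auto
  from bounded_preimage_functionals[OF fin this]
  obtain c where c: "c \<ge> 0" and c': "\<And>u. u \<in> carrier_vec m \<Longrightarrow> \<exists>u'\<in>carrier_vec m.
    (\<forall>q\<in>?R. q \<bullet> u' = q \<bullet> u) \<and> euclid_norm u' \<le> c * (\<Sum>q\<in>?R. \<bar>q \<bullet> u\<bar>)" by blast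
  have "\<exists>u'\<in>carrier_vec m. (\<forall>j\<in>J. B j *\<^sub>v u' = B j *\<^sub>v u) \<and>
    (\<forall>b\<ge>0. (\<forall>j\<in>J. euclid_norm (B j *\<^sub>v u) \<le> b) \<longrightarrow> euclid_norm u' \<le> c * real (card ?R) * b)"
    if u: "u \<in> carrier_vec m" for u
  proof -
    obtain u' where u': "u' \<in> carrier_vec m" "\<forall>q\<in>?R. q \<bullet> u' = q \<bullet> u"
      "euclid_norm u' \<le> c * (\<Sum>q\<in>?R. \<bar>q \<bullet> u\<bar>)" using c'[OF u] by blast
    have eqs: "B j *\<^sub>v u' = B j *\<^sub>v u" if "j \<in> J" for j
    proof (rule eq_vecI)
      fix i assume "i < dim_vec (B j *\<^sub>v u)"
      then show "(B j *\<^sub>v u') $ i = (B j *\<^sub>v u) $ i"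
        using assms(2)[OF that] u'(2) that by force
    qed simp
    have "euclid_norm u' \<le> c * real (card ?R) * b"
      if b: "\<forall>j\<in>J. euclid_norm (B j *\<^sub>v u) \<le> b" for b
    proof -
      have "\<bar>q \<bullet> u\<bar> \<le> b" if "q \<in> ?R" for q
      proof -
        from that obtain j i where q: "j \<in> J" "i < r" "q = row (B j) i" by auto
        then have "q \<bullet> u = (B j *\<^sub>v u) $ i" using assms(2)[OF q(1)] by simp
        then show ?thesis
          using euclid_norm_index_le[of i "B j *\<^sub>v u"] b q assms(2)[OF q(1)] by force
      qed
      then have "(\<Sum>q\<in>?R. \<bar>q \<bullet> u\<bar>) \<le> real (card ?R) * b"
        using sum_bounded_above[of ?R "\<lambda>q. \<bar>q \<bullet> u\<bar>" b] by simp
      then show ?thesis using u'(3) mult_left_mono[OF _ c] by (fastforce simp: mult.assoc)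
    qed
    then show ?thesis using eqs u' by blast
  qed
  then show ?thesis using c by (intro exI[of _ "c * real (card ?R)"]) auto
qed

subsection \<open>Closed loops and attainable rates\<close>

lemma admissible_family_const [simp]: "admissible_family k M (\<lambda>_. g)"
  by (cases k) auto

text \<open>Pointwise constructions from admissible families stay admissible. This and
  \<open>admissible_family_map2\<close> let both kinds of feedback be treated at once; only
  \<open>bounded_feedback_laws\<close> later distinguishes them.\<close>

lemma admissible_family_map:
  "admissible_family k M f \<Longrightarrow> admissible_family k M (\<lambda>j. h (f j))"
  by (cases k) auto

lemma admissible_family_map2:
  "admissible_family k M f \<Longrightarrow> admissible_family k M g \<Longrightarrow>
    admissible_family k M (\<lambda>j. h (f j) (g j))"
  by (cases k) force+

lemma signals_const: "j \<in> {1..M} \<Longrightarrow> (\<lambda>_. j) \<in> signals M"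
  by (simp add: signals_def)

lemma signalsD: "\<sigma> \<in> signals M \<Longrightarrow> \<sigma> t \<in> {1..M}"
  unfolding signals_def by blast

lemma signals_case_nat: "j \<in> {1..M} \<Longrightarrow> \<sigma> \<in> signals M \<Longrightarrow> case_nat j \<sigma> \<in> signals M"
  by (auto simp: signals_def split: nat.split)

lemma switched_systemD:
  assumes "switched_system M n m A B" "j \<in> {1..M}"
  shows "A j \<in> carrier_mat n n" "B j \<in> carrier_mat n m"
  using assms unfolding switched_system_def by blast+

lemma feedback_lawsD:
  "\<phi> \<in> feedback_laws k M n m \<Longrightarrow> j \<in> {1..M} \<Longrightarrow> x \<in> carrier_vec n \<Longrightarrow> \<phi> j x \<in> carrier_vec m"
  unfolding feedback_laws_def by blast

lemma closed_loop_iff: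
  assumes "\<phi> \<in> feedback_laws k M n m" "\<sigma> \<in> signals M"
  shows "closed_loop n m A B \<phi> \<sigma> x \<longleftrightarrow>
    (\<forall>t. x t \<in> carrier_vec n \<and> x (Suc t) = A (\<sigma> t) *\<^sub>v x t + B (\<sigma> t) *\<^sub>v \<phi> (\<sigma> t) (x t))"
  using feedback_lawsD[OF assms(1)] signalsD[OF assms(2)]
  unfolding closed_loop_def trajectory_def by blast

text \<open>A rate only constrains solutions, so an estimate at a prescribed state has to be read
  off from a solution that starts there.\<close>

lemma closed_loop_exists:
  assumes sys: "switched_system M n m A B" and \<phi>: "\<phi> \<in> feedback_laws k M n m"
    and \<sigma>: "\<sigma> \<in> signals M" and x0: "x0 \<in> carrier_vec n"
  obtains x where "closed_loop n m A B \<phi> \<sigma> x" "x 0 = x0"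
proof -
  define x where
    "x = rec_nat x0 (\<lambda>t x. A (\<sigma> t) *\<^sub>v x + B (\<sigma> t) *\<^sub>v \<phi> (\<sigma> t) x)"
  have x_Suc: "x (Suc t) = A (\<sigma> t) *\<^sub>v x t + B (\<sigma> t) *\<^sub>v \<phi> (\<sigma> t) (x t)" for t
    by (simp add: x_def)
  have "x t \<in> carrier_vec n" for t
  proof (induction t)
    case 0
    then show ?case using x0 by (simp add: x_def)
  next
    case (Suc t)
    then show ?case
      using switched_systemD[OF sys signalsD[OF \<sigma>]] feedback_lawsD[OF \<phi> signalsD[OF \<sigma>] Suc]
      unfolding x_Suc by (meson add_carrier_vec mult_mat_vec_carrier)
  qed
  then have "closed_loop n m A B \<phi> \<sigma> x" unfolding closed_loop_iff[OF \<phi> \<sigma>] using x_Suc by blast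
  moreover have "x 0 = x0" by (simp add: x_def)
  ultimately show ?thesis using that by blast
qed

text \<open>The dynamic programming device: bounds for solutions from \<open>x0\<close> turn into
  bounds, shifted by one time unit, for solutions from its successor.\<close>

lemma closed_loop_case_nat:
  assumes "\<phi> \<in> feedback_laws k M n m" "\<sigma> \<in> signals M" "j \<in> {1..M}" "x0 \<in> carrier_vec n"
    and "closed_loop n m A B \<phi> \<sigma> x" "x 0 = A j *\<^sub>v x0 + B j *\<^sub>v \<phi> j x0"
  shows "closed_loop n m A B \<phi> (case_nat j \<sigma>) (case_nat x0 x)"
  using assms unfolding closed_loop_iff[OF assms(1,2)]
    closed_loop_iff[OF assms(1) signals_case_nat[OF assms(3,2)]]
  by (auto split: nat.split)

text \<open>Allows passing to a larger positive rate, by which later estimates divide.\<close>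

lemma attainable_rate_mono:
  assumes "attainable_rate k M n m A B \<rho>" "\<rho> \<le> \<rho>'"
  shows "attainable_rate k M n m A B \<rho>'"
proof -
  from assms obtain \<phi> C where *: "0 \<le> \<rho>" "\<phi>\<in>feedback_laws k M n m" "C > 0"
    "\<And>\<sigma> x t. \<sigma>\<in>signals M \<Longrightarrow> closed_loop n m A B \<phi> \<sigma> x \<Longrightarrow>
        euclid_norm (x t) \<le> C * \<rho> ^ t * euclid_norm (x 0)"
    unfolding attainable_rate_def by blast
  have "euclid_norm (x t) \<le> C * \<rho>' ^ t * euclid_norm (x 0)"
    if "\<sigma>\<in>signals M" "closed_loop n m A B \<phi> \<sigma> x" for \<sigma> x t
  proof -
    have "C * \<rho> ^ t * euclid_norm (x 0) \<le> C * \<rho>' ^ t * euclid_norm (x 0)"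
      using * assms(2) by (intro mult_right_mono mult_left_mono power_mono) auto
    then show ?thesis using *(4)[OF that, of t] by linarith
  qed
  then show ?thesis using * assms(2) unfolding attainable_rate_def
    by (meson order_trans)
qed

section \<open>Comparison of infima of attainable rates\<close>

lemma Inf_le_if_above_mem:
  fixes S T :: "real set"
  assumes "T \<noteq> {}" "bdd_below S" "\<And>x y. x \<in> T \<Longrightarrow> x < y \<Longrightarrow> y \<in> S"
  shows "Inf S \<le> Inf T"
proof (rule cInf_greatest[OF assms(1)])
  fix x assume x: "x \<in> T"
  show "Inf S \<le> x"
  proof (rule dense_ge)
    fix y assume "x < y"
    then show "Inf S \<le> y" using assms(3)[OF x] by (intro cInf_lower[OF _ assms(2)])
  qed
qed

text \<open>Rates are transferred with an arbitrarily small loss, which infima do not see. If one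
  set is empty, so is the other, and both sides are the same unspecified value
  \<open>Inf {}\<close>.\<close>

lemma Inf_eq_if_interleaved:
  fixes X Y :: "real set"
  assumes "bdd_below X" "bdd_below Y"
    and XY: "\<And>x y. x \<in> X \<Longrightarrow> x < y \<Longrightarrow> y \<in> Y"
    and YX: "\<And>x y. x \<in> Y \<Longrightarrow> x < y \<Longrightarrow> y \<in> X"
  shows "Inf X = Inf Y"
proof (cases "X = {}")
  case True
  have "y \<notin> Y" for y using YX[of y "y + 1"] True by auto
  then have "Y = {}" by blast
  then show ?thesis using True by simp
next
  case False
  then obtain x where "x \<in> X" by blast
  then have "Y \<noteq> {}" using XY[of x "x + 1"] by auto
  then show ?thesis
    using False Inf_le_if_above_mem[OF _ assms(1) YX] Inf_le_if_above_mem[OF _ assms(2) XY]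
    by (intro order.antisym)
qed

lemma minimal_growth_rate_eqI:
  assumes "\<And>\<rho> \<rho>'. attainable_rate k M n m A B \<rho> \<Longrightarrow> \<rho> < \<rho>' \<Longrightarrow> attainable_rate k M n' m A' B' \<rho>'"
    and "\<And>\<rho> \<rho>'. attainable_rate k M n' m A' B' \<rho> \<Longrightarrow> \<rho> < \<rho>' \<Longrightarrow> attainable_rate k M n m A B \<rho>'"
  shows "minimal_growth_rate k M n m A B = minimal_growth_rate k M n' m A' B'"
  unfolding minimal_growth_rate_def
proof (rule Inf_eq_if_interleaved)
  show "bdd_below {\<rho>. attainable_rate k M n m A B \<rho>}"
    by (rule bdd_belowI[of _ 0]) (simp add: attainable_rate_def)
  show "bdd_below {\<rho>. attainable_rate k M n' m A' B' \<rho>}"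
    by (rule bdd_belowI[of _ 0]) (simp add: attainable_rate_def)
qed (simp_all add: assms)

text \<open>The state of least cost above \<open>\<xi>\<close>, up to the factor \<open>\<rho>' / \<rho>\<close>, supplies the feedback
  at \<open>\<xi>\<close>; the infimal cost is then a Lyapunov function of the factor system.\<close>

lemma attainable_rate_factor:
  assumes sys: "switched_system M n m A B" and sys': "switched_system M n' m A' B'"
    and K: "\<And>j. j \<in> {1..M} \<Longrightarrow> K j \<in> carrier_mat m n" "admissible_family k M K"
    and q: "\<And>x. x \<in> carrier_vec n \<Longrightarrow> q x \<in> carrier_vec n'"
      "\<And>x. x \<in> carrier_vec n \<Longrightarrow> euclid_norm (q x) \<le> c * euclid_norm x" "c > 0"
    and r: "\<And>\<xi>. \<xi> \<in> carrier_vec n' \<Longrightarrow> r \<xi> \<in> carrier_vec n \<and> q (r \<xi>) = \<xi>"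
      "\<And>\<xi>. \<xi> \<in> carrier_vec n' \<Longrightarrow> euclid_norm (r \<xi>) \<le> d * euclid_norm \<xi>" "d > 0"
    and step: "\<And>j x u. j \<in> {1..M} \<Longrightarrow> x \<in> carrier_vec n \<Longrightarrow> u \<in> carrier_vec m \<Longrightarrow>
      q (A j *\<^sub>v x + B j *\<^sub>v u) = A' j *\<^sub>v q x + B' j *\<^sub>v (u - K j *\<^sub>v x)"
    and att: "attainable_rate k M n m A B \<rho>\<^sub>0" and less: "\<rho>\<^sub>0 < \<rho>'"
  shows "attainable_rate k M n' m A' B' \<rho>'"
proof -
  \<comment> \<open>The midpoint is positive even when \<open>\<rho>\<^sub>0\<close> is 0, and it
    leaves room below \<rho>' for the factor \<theta> > 1.\<close>
  define \<rho> where "\<rho> = (\<rho>\<^sub>0 + \<rho>') / 2"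
  have "0 \<le> \<rho>\<^sub>0" using att by (simp add: attainable_rate_def)
  then have \<rho>: "0 < \<rho>" "\<rho> < \<rho>'" "\<rho>\<^sub>0 \<le> \<rho>" using less by (auto simp: \<rho>_def)
  define \<theta> where "\<theta> = \<rho>' / \<rho>"
  have \<theta>: "\<theta> > 1" "\<theta> * \<rho> = \<rho>'" using \<rho> by (auto simp: \<theta>_def)
  from attainable_rate_mono[OF att \<rho>(3)] obtain \<phi> C\<^sub>0 where \<phi>: "\<phi> \<in> feedback_laws k M n m"
    and C0: "C\<^sub>0 > 0" "\<And>\<sigma> x t. \<sigma> \<in> signals M \<Longrightarrow> closed_loop n m A B \<phi> \<sigma> x \<Longrightarrow>
        euclid_norm (x t) \<le> C\<^sub>0 * \<rho> ^ t * euclid_norm (x 0)"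
    unfolding attainable_rate_def by blast
  \<comment> \<open>The maximum with 1 makes \<open>C * euclid_norm x\<close> dominate the norm of
    \<open>x\<close> itself, as the first clause of \<open>cost\<close> demands.\<close>
  define C where "C = max C\<^sub>0 1"
  have C: "C \<ge> 1" "\<And>\<sigma> x t. \<sigma> \<in> signals M \<Longrightarrow> closed_loop n m A B \<phi> \<sigma> x \<Longrightarrow>
        euclid_norm (x t) \<le> C * euclid_norm (x 0) * \<rho> ^ t"
  proof -
    fix \<sigma> x t assume *: "\<sigma> \<in> signals M" "closed_loop n m A B \<phi> \<sigma> x"
    have "C\<^sub>0 * (\<rho> ^ t * euclid_norm (x 0)) \<le> C * (\<rho> ^ t * euclid_norm (x 0))"
      using \<rho> by (intro mult_right_mono) (auto simp: C_def)
    then show "euclid_norm (x t) \<le> C * euclid_norm (x 0) * \<rho> ^ t"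
      using C0(2)[OF *, of t] by (simp add: mult_ac)
  qed (simp add: C_def)
  \<comment> \<open>Without modes there are no signals and the second clause is vacuous; the
    separate first clause still bounds \<open>b\<close> from below.\<close>
  define cost where "cost = (\<lambda>b x. euclid_norm x \<le> b \<and> (\<forall>\<sigma>\<in>signals M. \<forall>X.
      closed_loop n m A B \<phi> \<sigma> X \<and> X 0 = x \<longrightarrow> (\<forall>t. euclid_norm (X t) \<le> b * \<rho> ^ t)))"
  define D where "D = (\<lambda>\<xi>. {b. \<exists>x\<in>carrier_vec n. q x = \<xi> \<and> cost b x})"
  define W where "W = (\<lambda>\<xi>. Inf (D \<xi>))"
  \<comment> \<open>The facts up to \<open>W_ge\<close> squeeze \<open>W\<close> between positive
    multiples of the Euclidean norm.\<close>
  have D_lower: "euclid_norm \<xi> / c \<le> b" if "b \<in> D \<xi>" for b \<xi>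
  proof -
    from that obtain x where "x \<in> carrier_vec n" "q x = \<xi>" "euclid_norm x \<le> b"
      unfolding D_def cost_def by blast
    moreover from this have "c * euclid_norm x \<le> c * b" using q(3) by (intro mult_left_mono) auto
    ultimately have "euclid_norm \<xi> \<le> c * b" using q(2)[of x] by simp
    then show ?thesis using q(3) by (simp add: divide_le_eq mult.commute)
  qed
  have cost_C: "cost (C * euclid_norm x) x" for x
  proof -
    have "1 * euclid_norm x \<le> C * euclid_norm x" using C(1) by (intro mult_right_mono) auto
    then show ?thesis using C(2) unfolding cost_def by auto
  qed
  have D_C: "C * euclid_norm (r \<xi>) \<in> D \<xi>" if "\<xi> \<in> carrier_vec n'" for \<xi>
    using r(1)[OF that] cost_C unfolding D_def by blast
  have bdd: "bdd_below (D \<xi>)" for \<xi> using D_lower by (intro bdd_belowI) blast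
  have W_le: "W \<xi> \<le> C * d * euclid_norm \<xi>" if "\<xi> \<in> carrier_vec n'" for \<xi>
  proof -
    have "C * euclid_norm (r \<xi>) \<le> C * (d * euclid_norm \<xi>)"
      using r(2)[OF that] C(1) by (intro mult_left_mono) auto
    then show ?thesis using cInf_lower[OF D_C[OF that] bdd] unfolding W_def by (simp add: mult.assoc)
  qed
  have W_ge: "euclid_norm \<xi> \<le> c * W \<xi>" if "\<xi> \<in> carrier_vec n'" for \<xi>
  proof -
    have "euclid_norm \<xi> / c \<le> W \<xi>" unfolding W_def
      using D_C[OF that] D_lower by (intro cInf_greatest) auto
    then show ?thesis using q(3) by (simp add: divide_le_eq mult.commute)
  qed
  have "\<exists>x\<in>carrier_vec n. q x = \<xi> \<and> cost (\<theta> * W \<xi>) x" if \<xi>: "\<xi> \<in> carrier_vec n'" for \<xi>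
  \<comment> \<open>At norm 0 the infimum is 0 and the factor \<theta> leaves no slack, but there
    \<open>r \<xi>\<close> also has norm 0 and attains the infimum.\<close>
  proof (cases "euclid_norm \<xi> = 0")
    case True
    then have "W \<xi> = 0" using W_le[OF \<xi>] W_ge[OF \<xi>] q(3) by (simp add: zero_le_mult_iff)
    moreover have "euclid_norm (r \<xi>) = 0"
      using r(2)[OF \<xi>] True euclid_norm_nonneg[of "r \<xi>"] by simp
    ultimately show ?thesis using cost_C[of "r \<xi>"] r(1)[OF \<xi>] by auto
  next
    case False
    then have "0 < c * W \<xi>" using W_ge[OF \<xi>] euclid_norm_nonneg[of \<xi>] by linarith
    then have "0 < W \<xi>" using q(3) by (simp add: zero_less_mult_iff)
    then have "Inf (D \<xi>) < \<theta> * W \<xi>" using \<theta>(1) unfolding W_def by simp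
    then obtain b where b: "b \<in> D \<xi>" "b < \<theta> * W \<xi>" using cInf_lessD[of "D \<xi>"] D_C[OF \<xi>] by blast
    then obtain x where x: "x \<in> carrier_vec n" "q x = \<xi>" "cost b x" unfolding D_def by blast
    have "b * \<rho> ^ t \<le> \<theta> * W \<xi> * \<rho> ^ t" for t using b \<rho> by (intro mult_right_mono) auto
    then have "cost (\<theta> * W \<xi>) x" using x(3) b(2) unfolding cost_def by (meson order_trans less_imp_le)
    then show ?thesis using x by blast
  qed
  then obtain s where s: "\<And>\<xi>. \<xi> \<in> carrier_vec n' \<Longrightarrow> s \<xi> \<in> carrier_vec n"
    "\<And>\<xi>. \<xi> \<in> carrier_vec n' \<Longrightarrow> q (s \<xi>) = \<xi>"
    "\<And>\<xi>. \<xi> \<in> carrier_vec n' \<Longrightarrow> cost (\<theta> * W \<xi>) (s \<xi>)" by metis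
  \<comment> \<open>The factor system receives the input reduced by the gain, hence the subtraction;
    both terms are taken at the representative \<open>s \<xi>\<close>.\<close>
  define \<psi> where "\<psi> = (\<lambda>j \<xi>. \<phi> j (s \<xi>) - K j *\<^sub>v s \<xi>)"
  have \<psi>: "\<psi> \<in> feedback_laws k M n' m"
  proof -
    have "\<psi> j \<xi> \<in> carrier_vec m" if "j \<in> {1..M}" "\<xi> \<in> carrier_vec n'" for j \<xi>
      using feedback_lawsD[OF \<phi> that(1) s(1)[OF that(2)]] K(1)[OF that(1)]
        s(1)[OF that(2)] unfolding \<psi>_def by auto
    moreover have "admissible_family k M \<psi>"
      using admissible_family_map2[OF _ K(2), of \<phi> "\<lambda>f L \<xi>. f (s \<xi>) - L *\<^sub>v s \<xi>"] \<phi>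
      unfolding \<psi>_def feedback_laws_def by simp
    ultimately show ?thesis unfolding feedback_laws_def by blast
  qed
  \<comment> \<open>The successor of \<open>s \<xi>\<close> lies above the successor of \<xi>, and
    dropping the first step of a solution multiplies the cost bound by \<rho>; then
    \<open>\<theta> * \<rho> = \<rho>'\<close> gives the rate.\<close>
  have W_step: "W (A' j *\<^sub>v \<xi> + B' j *\<^sub>v \<psi> j \<xi>) \<le> \<rho>' * W \<xi>"
    if j: "j \<in> {1..M}" and \<xi>: "\<xi> \<in> carrier_vec n'" for j \<xi>
  proof -
    define x where "x = A j *\<^sub>v s \<xi> + B j *\<^sub>v \<phi> j (s \<xi>)"
    note car = feedback_lawsD[OF \<phi> j s(1)[OF \<xi>]] switched_systemD[OF sys j]
    have x: "x \<in> carrier_vec n"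
      unfolding x_def using car s(1)[OF \<xi>] by (meson add_carrier_vec mult_mat_vec_carrier)
    have qx: "q x = A' j *\<^sub>v \<xi> + B' j *\<^sub>v \<psi> j \<xi>"
      using step[OF j s(1)[OF \<xi>] car(1)] s(2)[OF \<xi>] by (simp add: x_def \<psi>_def)
    have bound: "euclid_norm (X t) \<le> \<rho>' * W \<xi> * \<rho> ^ t"
      if "\<sigma> \<in> signals M" "closed_loop n m A B \<phi> \<sigma> X" "X 0 = x" for \<sigma> X t
    proof -
      have "closed_loop n m A B \<phi> (case_nat j \<sigma>) (case_nat (s \<xi>) X)"
        using closed_loop_case_nat[OF \<phi> that(1) j s(1)[OF \<xi>] that(2)] that(3) by (simp add: x_def)
      then have "euclid_norm (case_nat (s \<xi>) X (Suc t)) \<le> \<theta> * W \<xi> * \<rho> ^ Suc t"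
        using s(3)[OF \<xi>] signals_case_nat[OF j that(1)] unfolding cost_def by fastforce
      then show ?thesis unfolding \<theta>(2)[symmetric] by (simp add: mult_ac)
    qed
    \<comment> \<open>Some solution from \<open>x\<close> is needed to bound \<open>x\<close>
      itself, at time 0; the constant signal provides one.\<close>
    obtain X where "closed_loop n m A B \<phi> (\<lambda>_. j) X" "X 0 = x"
      using closed_loop_exists[OF sys \<phi> signals_const[OF j] x] .
    then have "euclid_norm x \<le> \<rho>' * W \<xi>" using bound[OF signals_const[OF j], of X 0] by simp
    then have "\<rho>' * W \<xi> \<in> D (q x)" using x bound unfolding D_def cost_def by blast
    then show ?thesis using cInf_lower[OF _ bdd] qx unfolding W_def by simp
  qed
  have "euclid_norm (X t) \<le> c * C * d * \<rho>' ^ t * euclid_norm (X 0)"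
    if \<sigma>: "\<sigma> \<in> signals M" and X: "closed_loop n' m A' B' \<psi> \<sigma> X" for \<sigma> X t
  proof -
    have X': "X t \<in> carrier_vec n'"
      "X (Suc t) = A' (\<sigma> t) *\<^sub>v X t + B' (\<sigma> t) *\<^sub>v \<psi> (\<sigma> t) (X t)" for t
      using X unfolding closed_loop_iff[OF \<psi> \<sigma>] by blast+
    have "W (X t) \<le> \<rho>' ^ t * W (X 0)"
    proof (induction t)
      case (Suc t)
      have "W (X (Suc t)) \<le> \<rho>' * W (X t)"
        using W_step[OF signalsD[OF \<sigma>] X'(1)] X'(2) by simp
      also have "\<dots> \<le> \<rho>' * (\<rho>' ^ t * W (X 0))" using Suc \<rho> by (intro mult_left_mono) auto
      finally show ?case by simp
    qed simp
    also have "\<dots> \<le> \<rho>' ^ t * (C * d * euclid_norm (X 0))"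
      using \<rho> W_le[OF X'(1)] by (intro mult_left_mono) auto
    finally have "c * W (X t) \<le> c * (\<rho>' ^ t * (C * d * euclid_norm (X 0)))"
      using q(3) by (intro mult_left_mono) auto
    then show ?thesis using W_ge[OF X'(1), of t] by (simp add: mult_ac)
  qed
  moreover have "c * C * d > 0" using q(3) C(1) r(3) by simp
  moreover have "0 \<le> \<rho>'" using \<rho> by simp
  ultimately show ?thesis using \<psi> unfolding attainable_rate_def by blast
qed

subsection \<open>Block triangular systems\<close>

lemma euclid_norm_le_dim_mult:
  assumes "x \<in> carrier_vec n" "\<And>i. i < n \<Longrightarrow> \<bar>x $ i\<bar> \<le> b"
  shows "euclid_norm x \<le> real n * b"
  using euclid_norm_le_sum[of x] sum_bounded_above[of "{..<n}" "\<lambda>i. \<bar>x $ i\<bar>" b] assms by fastforce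

text \<open>An inequality model of a block triangular closed loop: \<open>z t l\<close> stands for
  coordinate \<open>l\<close> at time \<open>t\<close> and \<open>N\<close> for the norm of the
  initial state. The sum over indices strictly above \<open>p\<close> reflects strict triangularity
  of the upper block.\<close>

definition cascade ::
    "real \<Rightarrow> real \<Rightarrow> real \<Rightarrow> nat \<Rightarrow> nat \<Rightarrow> (nat \<Rightarrow> nat \<Rightarrow> real) \<Rightarrow> real \<Rightarrow> bool" where
  "cascade \<rho> a b np n z N \<longleftrightarrow> 0 \<le> N \<and> (\<forall>l<n. \<bar>z 0 l\<bar> \<le> N) \<and>
    (\<forall>t l. np \<le> l \<longrightarrow> l < n \<longrightarrow> \<bar>z t l\<bar> \<le> b * \<rho> ^ t * N) \<and>
    (\<forall>t p. p < np \<longrightarrow> \<bar>z (Suc t) p\<bar> \<le> b * \<rho> ^ t * N + a * (\<Sum>l\<in>{p<..<n}. \<bar>z t l\<bar>))"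

text \<open>An upper coordinate is driven only by later ones and never by itself, so bounds of rate
  \<rho> propagate from the last coordinate to the first without worsening the rate. The constant
  \<open>E\<close> does not depend on \<open>z\<close> or \<open>N\<close>.\<close>

lemma cascade_bound:
  assumes \<rho>: "0 < \<rho>" and a: "0 \<le> a" and b: "0 \<le> b" and np: "np \<le> n"
  obtains E where "0 \<le> E"
    "\<And>z N t l. cascade \<rho> a b np n z N \<Longrightarrow> l < n \<Longrightarrow> \<bar>z t l\<bar> \<le> E * \<rho> ^ t * N"
proof -
  \<comment> \<open>Here \<open>i\<close> counts the upper coordinates already treated, from the
    bottom; at \<open>i = np\<close> all coordinates are covered.\<close>
  have "\<exists>E\<ge>0. \<forall>z N t l. cascade \<rho> a b np n z N \<longrightarrow> np - i \<le> l \<longrightarrow> l < n \<longrightarrow>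
    \<bar>z t l\<bar> \<le> E * \<rho> ^ t * N" for i
  proof (induction i)
    case 0
    show ?case using b by (intro exI[of _ b]) (auto simp: cascade_def)
  next
    case (Suc i)
    then obtain E where E: "E \<ge> 0" and IH: "\<And>z N t l. cascade \<rho> a b np n z N \<Longrightarrow>
        np - i \<le> l \<Longrightarrow> l < n \<Longrightarrow> \<bar>z t l\<bar> \<le> E * \<rho> ^ t * N" by blast
    \<comment> \<open>Dividing by \<rho> turns \<open>\<rho> ^ s\<close> at the previous time into
      \<open>\<rho> ^ t\<close> for \<open>t = Suc s\<close>. In \<open>?E\<close> the summand
      \<open>E\<close> serves the coordinates already treated, 1 the time 0, and \<open>F\<close>
      the new coordinate at positive times.\<close>
    define F where "F = (b + a * (real n * E)) / \<rho>"
    have F: "F \<ge> 0" using a b \<rho> E by (simp add: F_def)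
    let ?E = "E + 1 + F"
    have "\<bar>z t l\<bar> \<le> ?E * \<rho> ^ t * N" if z: "cascade \<rho> a b np n z N"
      and l: "np - Suc i \<le> l" "l < n" for z N t l
    proof -
      have N: "0 \<le> N" "\<forall>l<n. \<bar>z 0 l\<bar> \<le> N"
        and rec: "\<And>t p. p < np \<Longrightarrow>
          \<bar>z (Suc t) p\<bar> \<le> b * \<rho> ^ t * N + a * (\<Sum>l\<in>{p<..<n}. \<bar>z t l\<bar>)"
        using z unfolding cascade_def by blast+
      note IH' = IH[OF z]
      have pos: "0 \<le> \<rho> ^ t * N" using \<rho> N(1) by simp
      show ?thesis
      proof (cases "np - i \<le> l")
        case True
        have "E * (\<rho> ^ t * N) \<le> ?E * (\<rho> ^ t * N)" using pos F by (intro mult_right_mono) auto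
        then show ?thesis using IH'[OF True l(2), of t] by (simp add: mult.assoc)
      next
        case False
        show ?thesis
        proof (cases t)
          case 0
          have "1 * N \<le> ?E * N" using N(1) E F by (intro mult_right_mono) auto
          then show ?thesis using N(2) l(2) 0 by force
        next
          case (Suc s)
          have "(\<Sum>k\<in>{l<..<n}. \<bar>z s k\<bar>) \<le> real (card {l<..<n}) * (E * \<rho> ^ s * N)"
            using IH'[of _ s] False l by (intro sum_bounded_above) auto
          also have "\<dots> \<le> real n * (E * \<rho> ^ s * N)"
            using E \<rho> N(1) by (intro mult_right_mono) (auto simp: le_diff_conv)
          finally have "a * (\<Sum>k\<in>{l<..<n}. \<bar>z s k\<bar>) \<le> a * (real n * (E * \<rho> ^ s * N))"
            using a by (intro mult_left_mono)
          moreover have "l < np" using False l by simp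
          then have "\<bar>z t l\<bar> \<le> b * \<rho> ^ s * N + a * (\<Sum>k\<in>{l<..<n}. \<bar>z s k\<bar>)"
            using rec Suc by blast
          ultimately have "\<bar>z t l\<bar> \<le> b * \<rho> ^ s * N + a * (real n * (E * \<rho> ^ s * N))"
            by linarith
          also have "\<dots> = (b + a * (real n * E)) * \<rho> ^ s * N" by (simp add: algebra_simps)
          also have "\<dots> = F * (\<rho> ^ t * N)" using \<rho> by (simp add: F_def Suc)
          also have "\<dots> \<le> ?E * (\<rho> ^ t * N)" using pos E by (intro mult_right_mono) auto
          finally show ?thesis by (simp add: mult.assoc)
        qed
      qed
    qed
    moreover have "?E \<ge> 0" using E F by simp
    ultimately show ?case by blast
  qed
  from this[of np] that show ?thesis by auto
qed

section \<open>Tails of vectors and blocks of matrices\<close>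

definition tail_vec :: "nat \<Rightarrow> 'a vec \<Rightarrow> 'a vec" where
  "tail_vec k x = vec (dim_vec x - k) (\<lambda>i. x $ (i + k))"

definition block_mat :: "nat \<Rightarrow> nat \<Rightarrow> nat \<Rightarrow> nat \<Rightarrow> 'a mat \<Rightarrow> 'a mat" where
  "block_mat r\<^sub>0 c\<^sub>0 nr nc A = mat nr nc (\<lambda>(i, j). A $$ (i + r\<^sub>0, j + c\<^sub>0))"

lemma block_mat_carrier [simp]: "block_mat r\<^sub>0 c\<^sub>0 nr nc A \<in> carrier_mat nr nc"
  by (simp add: block_mat_def)

lemma tail_vec_carrier: "x \<in> carrier_vec n \<Longrightarrow> tail_vec k x \<in> carrier_vec (n - k)"
  by (auto simp: tail_vec_def)

lemma tail_vec_index: "x \<in> carrier_vec n \<Longrightarrow> i < n - k \<Longrightarrow> tail_vec k x $ i = x $ (i + k)"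
  by (auto simp: tail_vec_def)

lemma euclid_norm_tail_vec:
  assumes "x \<in> carrier_vec n"
  shows "euclid_norm (tail_vec k x) \<le> (1 + real n) * euclid_norm x"
proof -
  have "euclid_norm (tail_vec k x) \<le> real (n - k) * euclid_norm x"
    using assms euclid_norm_index_le[of _ x]
    by (intro euclid_norm_le_dim_mult tail_vec_carrier) (auto simp: tail_vec_index)
  also have "\<dots> \<le> (1 + real n) * euclid_norm x" by (intro mult_right_mono) auto
  finally show ?thesis .
qed

text \<open>The vanishing lower left block lets the last \<open>n - k\<close> coordinates evolve on
  their own, so \<open>tail_vec k\<close> is the factor map onto the lower subsystem.\<close>

lemma tail_vec_step:
  fixes A B :: "'a :: comm_ring_1 mat"
  assumes A: "A \<in> carrier_mat n n" and B: "B \<in> carrier_mat n m"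
    and x: "x \<in> carrier_vec n" and u: "u \<in> carrier_vec m" and k: "k \<le> n"
    and zero: "\<And>a b. b < k \<Longrightarrow> k \<le> a \<Longrightarrow> a < n \<Longrightarrow> A $$ (a, b) = 0"
  shows "tail_vec k (A *\<^sub>v x + B *\<^sub>v u) =
    block_mat k k (n - k) (n - k) A *\<^sub>v tail_vec k x + block_mat k 0 (n - k) m B *\<^sub>v u"
proof (rule eq_vecI)
  fix i assume "i < dim_vec (block_mat k k (n - k) (n - k) A *\<^sub>v tail_vec k x +
    block_mat k 0 (n - k) m B *\<^sub>v u)"
  then have i: "i < n - k" by (simp add: block_mat_def)
  have "(\<Sum>l\<in>{0..<n}. A $$ (i + k, l) * x $ l) = (\<Sum>l\<in>{k..<n}. A $$ (i + k, l) * x $ l)"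
    using i k by (intro sum.mono_neutral_right) (auto simp: zero)
  also have "\<dots> = (\<Sum>l\<in>{0..<n - k}. A $$ (i + k, l + k) * x $ (l + k))"
    using sum.shift_bounds_nat_ivl[of "\<lambda>l. A $$ (i + k, l) * x $ l" 0 k "n - k"] k by simp
  finally have sum: "row A (i + k) \<bullet> x =
      (\<Sum>l\<in>{0..<n - k}. A $$ (i + k, l + k) * x $ (l + k))"
    using A x i by (simp add: scalar_prod_def)
  have "row (block_mat k 0 (n - k) m B) i = row B (i + k)"
    using B i by (intro eq_vecI) (auto simp: block_mat_def)
  moreover have car: "A *\<^sub>v x + B *\<^sub>v u \<in> carrier_vec n"
    using A B x u by (meson add_carrier_vec mult_mat_vec_carrier)
  moreover have "row (block_mat k k (n - k) (n - k) A) i \<bullet> tail_vec k x = row A (i + k) \<bullet> x"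
    unfolding sum using i x by (simp add: scalar_prod_def block_mat_def tail_vec_def)
  ultimately show "tail_vec k (A *\<^sub>v x + B *\<^sub>v u) $ i = (block_mat k k (n - k) (n - k) A *\<^sub>v
      tail_vec k x + block_mat k 0 (n - k) m B *\<^sub>v u) $ i"
    using i A B tail_vec_index[OF car i] by (simp add: block_mat_def)
qed (use A B in \<open>simp add: tail_vec_def block_mat_def\<close>)

text \<open>Only the effect \<open>B j *\<^sub>v \<phi> j x\<close> enters the closed loop, so each
  input may be replaced by one with the same effect and of comparable size. A mode-independent law
  must keep the effect under all modes at once, a mode-dependent one only under its own mode, which
  is why the cases differ.\<close>

lemma bounded_feedback_laws:
  assumes sys: "switched_system M n m A B" and \<phi>: "\<phi> \<in> feedback_laws k M n m" and C: "C \<ge> 0"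
    and bound: "\<And>j x. j \<in> {1..M} \<Longrightarrow> x \<in> carrier_vec n \<Longrightarrow>
      euclid_norm (B j *\<^sub>v \<phi> j x) \<le> C * euclid_norm x"
  obtains \<psi> c where "\<psi> \<in> feedback_laws k M n m" "c \<ge> 0"
    "\<And>j x. j \<in> {1..M} \<Longrightarrow> x \<in> carrier_vec n \<Longrightarrow> B j *\<^sub>v \<psi> j x = B j *\<^sub>v \<phi> j x"
    "\<And>j x. j \<in> {1..M} \<Longrightarrow> x \<in> carrier_vec n \<Longrightarrow> euclid_norm (\<psi> j x) \<le> c * euclid_norm x"
proof (cases k)
  case Mode_Independent
  then obtain g where g: "\<And>j. j \<in> {1..M} \<Longrightarrow> \<phi> j = g" using \<phi> unfolding feedback_laws_def by auto
  have "\<exists>c\<ge>0. \<forall>u\<in>carrier_vec m. \<exists>u'\<in>carrier_vec m.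
    (\<forall>j\<in>{1..M}. B j *\<^sub>v u' = B j *\<^sub>v u) \<and>
    (\<forall>b\<ge>0. (\<forall>j\<in>{1..M}. euclid_norm (B j *\<^sub>v u) \<le> b) \<longrightarrow> euclid_norm u' \<le> c * b)"
    by (rule bounded_preimage_mats) (use switched_systemD(2)[OF sys] in auto)
  then obtain c h where c: "c \<ge> 0" and h: "\<And>u. u \<in> carrier_vec m \<Longrightarrow> h u \<in> carrier_vec m \<and>
    (\<forall>j\<in>{1..M}. B j *\<^sub>v h u = B j *\<^sub>v u) \<and>
    (\<forall>b\<ge>0. (\<forall>j\<in>{1..M}. euclid_norm (B j *\<^sub>v u) \<le> b) \<longrightarrow> euclid_norm (h u) \<le> c * b)" by metis
  have gx: "g x \<in> carrier_vec m" if "j \<in> {1..M}" "x \<in> carrier_vec n" for j x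
    using feedback_lawsD[OF \<phi> that] g[OF that(1)] by simp
  show ?thesis
  proof
    show "(\<lambda>_ x. h (g x)) \<in> feedback_laws k M n m"
      using h gx unfolding feedback_laws_def by auto
    show "c * C \<ge> 0" using c C by simp
    fix j and x :: "real vec" assume j: "j \<in> {1..M}" and x: "x \<in> carrier_vec n"
    show "B j *\<^sub>v h (g x) = B j *\<^sub>v \<phi> j x" using h[OF gx[OF j x]] g[OF j] j by simp
    have "\<forall>i\<in>{1..M}. euclid_norm (B i *\<^sub>v g x) \<le> C * euclid_norm x"
      using bound[OF _ x] g by simp
    moreover have "0 \<le> C * euclid_norm x" using C by simp
    ultimately show "euclid_norm (h (g x)) \<le> c * C * euclid_norm x"
      using h[OF gx[OF j x]] by (simp add: mult.assoc)
  qed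
next
  case Mode_Dependent
  have "\<forall>j\<in>{1..M}. \<exists>c\<ge>0. \<forall>u\<in>carrier_vec m. \<exists>u'\<in>carrier_vec m.
    (\<forall>i\<in>{j}. B i *\<^sub>v u' = B i *\<^sub>v u) \<and>
    (\<forall>b\<ge>0. (\<forall>i\<in>{j}. euclid_norm (B i *\<^sub>v u) \<le> b) \<longrightarrow> euclid_norm u' \<le> c * b)"
  proof
    fix j assume "j \<in> {1..M}"
    then show "\<exists>c\<ge>0. \<forall>u\<in>carrier_vec m. \<exists>u'\<in>carrier_vec m.
      (\<forall>i\<in>{j}. B i *\<^sub>v u' = B i *\<^sub>v u) \<and>
      (\<forall>b\<ge>0. (\<forall>i\<in>{j}. euclid_norm (B i *\<^sub>v u) \<le> b) \<longrightarrow> euclid_norm u' \<le> c * b)"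
      using switched_systemD(2)[OF sys] by (intro bounded_preimage_mats) auto
  qed
  then have "\<forall>j\<in>{1..M}. \<exists>c. c \<ge> 0 \<and> (\<exists>h. \<forall>u\<in>carrier_vec m. h u \<in> carrier_vec m \<and>
      B j *\<^sub>v h u = B j *\<^sub>v u \<and>
      (\<forall>b\<ge>0. euclid_norm (B j *\<^sub>v u) \<le> b \<longrightarrow> euclid_norm (h u) \<le> c * b))" by (simp; metis)
  then obtain c h where c: "\<And>j. j \<in> {1..M} \<Longrightarrow> c j \<ge> 0" and
    h: "\<And>j u. j \<in> {1..M} \<Longrightarrow> u \<in> carrier_vec m \<Longrightarrow> h j u \<in> carrier_vec m \<and>
      B j *\<^sub>v h j u = B j *\<^sub>v u \<and>
      (\<forall>b\<ge>0. euclid_norm (B j *\<^sub>v u) \<le> b \<longrightarrow> euclid_norm (h j u) \<le> c j * b)" by metis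
  \<comment> \<open>The sum dominates every \<open>c j\<close> and thus gives one constant for all
    modes.\<close>
  define c' where "c' = (\<Sum>j\<in>{1..M}. c j)"
  have c': "c' \<ge> 0" "\<And>j. j \<in> {1..M} \<Longrightarrow> c j \<le> c'"
    unfolding c'_def using c by (auto intro!: sum_nonneg member_le_sum)
  note \<phi>x = feedback_lawsD[OF \<phi>]
  show ?thesis
  proof
    show "(\<lambda>j x. h j (\<phi> j x)) \<in> feedback_laws k M n m"
      using h \<phi>x Mode_Dependent unfolding feedback_laws_def by auto
    show "c' * C \<ge> 0" using c' C by simp
    fix j and x :: "real vec" assume j: "j \<in> {1..M}" and x: "x \<in> carrier_vec n"
    show "B j *\<^sub>v h j (\<phi> j x) = B j *\<^sub>v \<phi> j x" using h[OF j \<phi>x[OF j x]] by simp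
    have pos: "0 \<le> C * euclid_norm x" using C by simp
    then have "euclid_norm (h j (\<phi> j x)) \<le> c j * (C * euclid_norm x)"
      using h[OF j \<phi>x[OF j x]] bound[OF j x] by simp
    also have "\<dots> \<le> c' * (C * euclid_norm x)" using c'(2)[OF j] pos by (rule mult_right_mono)
    finally show "euclid_norm (h j (\<phi> j x)) \<le> c' * C * euclid_norm x" by (simp add: mult.assoc)
  qed
qed

lemma row_upper_triangular_scalar_prod:
  fixes A :: "'a :: comm_ring_1 mat"
  assumes "A \<in> carrier_mat n n" "x \<in> carrier_vec n" "p < k" "k \<le> n"
    and zero: "\<And>a b. b < k \<Longrightarrow> b \<le> a \<Longrightarrow> a < n \<Longrightarrow> A $$ (a, b) = 0"
  shows "row A p \<bullet> x = (\<Sum>l\<in>{p<..<n}. A $$ (p, l) * x $ l)"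
proof -
  have "row A p \<bullet> x = (\<Sum>l\<in>{0..<n}. A $$ (p, l) * x $ l)"
    using assms by (simp add: scalar_prod_def)
  also have "\<dots> = (\<Sum>l\<in>{p<..<n}. A $$ (p, l) * x $ l)"
    using assms by (intro sum.mono_neutral_right) (auto simp: zero not_less)
  finally show ?thesis .
qed

text \<open>The feedback attaining \<open>\<rho>\<close> for the lower block may be unbounded along the common kernel of the
  lower input matrices, which would excite the upper block; hence it is first replaced by a bounded one.\<close>

lemma attainable_rate_cascade:
  assumes sys: "switched_system M n m A B" and np: "np \<le> n"
    and zero: "\<And>j a b. j \<in> {1..M} \<Longrightarrow> b < np \<Longrightarrow> b \<le> a \<Longrightarrow> a < n \<Longrightarrow> A j $$ (a, b) = 0"
    and att: "attainable_rate k M (n - np) m (\<lambda>j. block_mat np np (n - np) (n - np) (A j))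
      (\<lambda>j. block_mat np 0 (n - np) m (B j)) \<rho>"
    and \<rho>: "0 < \<rho>"
  shows "attainable_rate k M n m A B \<rho>"
proof -
  let ?A = "\<lambda>j. block_mat np np (n - np) (n - np) (A j)"
  let ?B = "\<lambda>j. block_mat np 0 (n - np) m (B j)"
  have sys': "switched_system M (n - np) m ?A ?B" by (simp add: switched_system_def)
  from att obtain \<phi> C where \<phi>: "\<phi> \<in> feedback_laws k M (n - np) m"
    and C: "C > 0" "\<And>\<sigma> x t. \<sigma> \<in> signals M \<Longrightarrow> closed_loop (n - np) m ?A ?B \<phi> \<sigma> x \<Longrightarrow>
        euclid_norm (x t) \<le> C * \<rho> ^ t * euclid_norm (x 0)"
    unfolding attainable_rate_def by blast
  obtain \<alpha> where \<alpha>: "\<alpha> > 0" "\<And>j x. j \<in> {1..M} \<Longrightarrow> x \<in> carrier_vec (n - np) \<Longrightarrow>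
      euclid_norm (?A j *\<^sub>v x) \<le> \<alpha> * euclid_norm x"
    using euclid_norm_mult_mat_vec_bound_family[of "{1..M}" ?A "n - np"]
    by (auto simp: block_mat_def)
  \<comment> \<open>The effect of the input is the state at time 1 minus
    \<open>?A j *\<^sub>v x\<close>, and the rate bound at time 1 under the constant signal controls
    that state.\<close>
  have "euclid_norm (?B j *\<^sub>v \<phi> j x) \<le> (C * \<rho> + \<alpha>) * euclid_norm x"
    if j: "j \<in> {1..M}" and x: "x \<in> carrier_vec (n - np)" for j x
  proof -
    obtain X where X: "closed_loop (n - np) m ?A ?B \<phi> (\<lambda>_. j) X" "X 0 = x"
      using closed_loop_exists[OF sys' \<phi> signals_const[OF j] x] .
    have Ax: "?A j *\<^sub>v x \<in> carrier_vec (n - np)" by (rule mult_mat_vec_carrier[OF block_mat_carrier x])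
    have Bx: "?B j *\<^sub>v \<phi> j x \<in> carrier_vec (n - np)"
      by (rule mult_mat_vec_carrier[OF block_mat_carrier feedback_lawsD[OF \<phi> j x]])
    have "X (Suc 0) = ?A j *\<^sub>v X 0 + ?B j *\<^sub>v \<phi> j (X 0)"
      using X(1) closed_loop_iff[OF \<phi> signals_const[OF j]] by simp
    then have X1: "X 1 = ?A j *\<^sub>v x + ?B j *\<^sub>v \<phi> j x" using X(2) by simp
    have "?B j *\<^sub>v \<phi> j x = X 1 + - (?A j *\<^sub>v x)"
      unfolding X1 using Ax Bx by (intro eq_vecI) (auto simp: block_mat_def)
    moreover have "X 1 \<in> carrier_vec (n - np)" unfolding X1 using Ax Bx by simp
    ultimately have "euclid_norm (?B j *\<^sub>v \<phi> j x) \<le> euclid_norm (X 1) + euclid_norm (?A j *\<^sub>v x)"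
      using euclid_norm_triangle[of "X 1" "n - np" "- (?A j *\<^sub>v x)"] Ax
      by (simp only: euclid_norm_uminus uminus_carrier_vec)
    also have "\<dots> \<le> C * \<rho> * euclid_norm x + \<alpha> * euclid_norm x"
      using C(2)[OF signals_const[OF j] X(1), of 1] X(2) \<alpha>(2)[OF j x] by simp
    finally show ?thesis by (simp add: distrib_right)
  qed
  moreover have "C * \<rho> + \<alpha> \<ge> 0" using C \<rho> \<alpha> by simp
  ultimately obtain \<psi> c where \<psi>: "\<psi> \<in> feedback_laws k M (n - np) m" and c: "c \<ge> 0"
    and \<psi>_eq: "\<And>j x. j \<in> {1..M} \<Longrightarrow> x \<in> carrier_vec (n - np) \<Longrightarrow> ?B j *\<^sub>v \<psi> j x = ?B j *\<^sub>v \<phi> j x"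
    and \<psi>_bound: "\<And>j x. j \<in> {1..M} \<Longrightarrow> x \<in> carrier_vec (n - np) \<Longrightarrow>
      euclid_norm (\<psi> j x) \<le> c * euclid_norm x"
    using bounded_feedback_laws[OF sys' \<phi>] by blast
  \<comment> \<open>The law reads only the tail; the strictly triangular upper block merely
    follows.\<close>
  define \<chi> where "\<chi> = (\<lambda>j x. \<psi> j (tail_vec np x))"
  have \<chi>: "\<chi> \<in> feedback_laws k M n m"
  proof -
    have "\<chi> j x \<in> carrier_vec m" if "j \<in> {1..M}" "x \<in> carrier_vec n" for j x
      unfolding \<chi>_def by (rule feedback_lawsD[OF \<psi> that(1) tail_vec_carrier[OF that(2)]])
    moreover have "admissible_family k M \<chi>"
      using admissible_family_map[of k M \<psi> "\<lambda>f x. f (tail_vec np x)"] \<psi>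
      unfolding \<chi>_def feedback_laws_def by simp
    ultimately show ?thesis unfolding feedback_laws_def by blast
  qed
  obtain \<beta> where \<beta>: "\<beta> > 0" "\<And>j x. j \<in> {1..M} \<Longrightarrow> x \<in> carrier_vec m \<Longrightarrow>
      euclid_norm (B j *\<^sub>v x) \<le> \<beta> * euclid_norm x"
  proof (rule euclid_norm_mult_mat_vec_bound_family[of "{1..M}" B m])
    show "dim_col (B j) = m" if "j \<in> {1..M}" for j
      using switched_systemD(2)[OF sys that] by simp
  qed (use that in auto)
  define a where "a = (\<Sum>j\<in>{1..M}. \<Sum>i<n. \<Sum>l<n. \<bar>A j $$ (i, l)\<bar>)"
  have a: "\<bar>A j $$ (i, l)\<bar> \<le> a" if "j \<in> {1..M}" "i < n" "l < n" for i j l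
  proof -
    have "\<bar>A j $$ (i, l)\<bar> \<le> (\<Sum>l<n. \<bar>A j $$ (i, l)\<bar>)"
      using that by (intro member_le_sum) auto
    also have "\<dots> \<le> (\<Sum>i<n. \<Sum>l<n. \<bar>A j $$ (i, l)\<bar>)"
      using that by (intro member_le_sum) (auto intro: sum_nonneg)
    also have "\<dots> \<le> a" unfolding a_def
      using that by (intro member_le_sum) (auto intro!: sum_nonneg)
    finally show ?thesis .
  qed
  have a0: "0 \<le> a" unfolding a_def by (intro sum_nonneg) auto
  \<comment> \<open>\<open>e\<close> is the constant for the tail, with \<open>1 + real n\<close>
    passing from the initial tail to the full initial state. In \<open>b\<close> below,
    \<open>e\<close> bounds the lower coordinates and \<open>\<beta> * (c * e)\<close> the effect of
    the input on the upper ones.\<close>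
  define e where "e = C * (1 + real n)"
  have e: "e \<ge> 0" using C by (simp add: e_def)
  define b where "b = e + \<beta> * (c * e)"
  have b: "b \<ge> 0" "e \<le> b" "\<beta> * (c * e) \<le> b" using e \<beta> c by (auto simp: b_def)
  obtain E where E: "E \<ge> 0" and E_bound:
    "\<And>z N t l. cascade \<rho> a b np n z N \<Longrightarrow> l < n \<Longrightarrow> \<bar>z t l\<bar> \<le> E * \<rho> ^ t * N"
    using cascade_bound[OF \<rho> a0 b(1) np] by blast
  have "euclid_norm (X t) \<le> (1 + real n * E) * \<rho> ^ t * euclid_norm (X 0)"
    if \<sigma>: "\<sigma> \<in> signals M" and X: "closed_loop n m A B \<chi> \<sigma> X" for \<sigma> X t
  proof -
    have Xc: "X t \<in> carrier_vec n" and
      X_Suc: "X (Suc t) = A (\<sigma> t) *\<^sub>v X t + B (\<sigma> t) *\<^sub>v \<chi> (\<sigma> t) (X t)" for t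
      using X unfolding closed_loop_iff[OF \<chi> \<sigma>] by blast+
    note sysD = switched_systemD[OF sys signalsD[OF \<sigma>]]
    define \<xi> where "\<xi> = (\<lambda>t. tail_vec np (X t))"
    define N where "N = euclid_norm (X 0)"
    have N: "0 \<le> N" by (simp add: N_def)
    have \<xi>c: "\<xi> t \<in> carrier_vec (n - np)" for t unfolding \<xi>_def by (rule tail_vec_carrier[OF Xc])
    have \<chi>c: "\<chi> (\<sigma> t) (X t) \<in> carrier_vec m" for t
      using feedback_lawsD[OF \<chi> signalsD[OF \<sigma>] Xc] .
    \<comment> \<open>Since \<psi> and \<phi> have the same effect on the lower block, the tail
      solves the closed loop of \<phi>, whose rate is known.\<close>
    have "\<xi> (Suc t) = ?A (\<sigma> t) *\<^sub>v \<xi> t + ?B (\<sigma> t) *\<^sub>v \<phi> (\<sigma> t) (\<xi> t)" for t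
    proof -
      have "\<xi> (Suc t) = ?A (\<sigma> t) *\<^sub>v \<xi> t + ?B (\<sigma> t) *\<^sub>v \<psi> (\<sigma> t) (\<xi> t)"
        using tail_vec_step[OF sysD Xc \<chi>c np] zero[OF signalsD[OF \<sigma>]]
        unfolding \<xi>_def X_Suc by (simp add: \<chi>_def)
      then show ?thesis using \<psi>_eq[OF signalsD[OF \<sigma>] \<xi>c] by simp
    qed
    then have "closed_loop (n - np) m ?A ?B \<phi> \<sigma> \<xi>"
      unfolding closed_loop_iff[OF \<phi> \<sigma>] using \<xi>c by blast
    note \<xi>_bound0 = C(2)[OF \<sigma> this]
    have \<xi>_bound: "euclid_norm (\<xi> t) \<le> e * \<rho> ^ t * N" for t
    proof -
      have "C * \<rho> ^ t * euclid_norm (\<xi> 0) \<le> C * \<rho> ^ t * ((1 + real n) * N)"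
        unfolding \<xi>_def N_def using euclid_norm_tail_vec[OF Xc, of np 0] C \<rho>
        by (intro mult_left_mono) auto
      then show ?thesis using \<xi>_bound0[of t] by (simp add: e_def mult_ac)
    qed
    have pos: "0 \<le> \<rho> ^ t * N" for t using \<rho> N by simp
    have 1: "\<forall>l<n. \<bar>X 0 $ l\<bar> \<le> N"
      unfolding N_def using euclid_norm_index_le[of _ "X 0"] Xc[of 0] by auto
    have 2: "\<forall>t l. np \<le> l \<longrightarrow> l < n \<longrightarrow> \<bar>X t $ l\<bar> \<le> b * \<rho> ^ t * N"
    proof (intro allI impI)
      fix t l assume l: "np \<le> l" "l < n"
      have "\<bar>X t $ l\<bar> = \<bar>\<xi> t $ (l - np)\<bar>"
        unfolding \<xi>_def using l by (subst tail_vec_index[OF Xc]) auto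
      also have "\<dots> \<le> euclid_norm (\<xi> t)"
        using \<xi>c[of t] l by (intro euclid_norm_index_le) auto
      also have "\<dots> \<le> e * \<rho> ^ t * N" by (rule \<xi>_bound)
      also have "\<dots> \<le> b * \<rho> ^ t * N"
        using mult_right_mono[OF b(2) pos[of t]] by (simp add: mult.assoc)
      finally show "\<bar>X t $ l\<bar> \<le> b * \<rho> ^ t * N" .
    qed
    have 3: "\<forall>t p. p < np \<longrightarrow>
      \<bar>X (Suc t) $ p\<bar> \<le> b * \<rho> ^ t * N + a * (\<Sum>l\<in>{p<..<n}. \<bar>X t $ l\<bar>)"
    proof (intro allI impI)
      fix t p assume p: "p < np"
      have pn: "p < n" using p np by simp
      let ?u = "\<chi> (\<sigma> t) (X t)"
      have "euclid_norm (B (\<sigma> t) *\<^sub>v ?u) \<le> \<beta> * euclid_norm ?u"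
        using \<beta>(2)[OF signalsD[OF \<sigma>] \<chi>c] .
      also have "\<dots> \<le> \<beta> * (c * euclid_norm (\<xi> t))"
        using \<psi>_bound[OF signalsD[OF \<sigma>] \<xi>c] \<beta>(1) unfolding \<chi>_def \<xi>_def by simp
      also have "\<dots> \<le> \<beta> * (c * (e * \<rho> ^ t * N))"
        using \<xi>_bound c \<beta>(1) by (intro mult_left_mono) auto
      also have "\<dots> = \<beta> * (c * e) * (\<rho> ^ t * N)" by (simp add: mult_ac)
      also have "\<dots> \<le> b * (\<rho> ^ t * N)" using b(3) pos by (rule mult_right_mono)
      finally have Bu: "\<bar>(B (\<sigma> t) *\<^sub>v ?u) $ p\<bar> \<le> b * \<rho> ^ t * N"
        using euclid_norm_index_le[of p "B (\<sigma> t) *\<^sub>v ?u"] sysD(2)[of t] pn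
        by (simp add: mult.assoc)
      have "\<bar>row (A (\<sigma> t)) p \<bullet> X t\<bar> \<le> (\<Sum>l\<in>{p<..<n}. \<bar>A (\<sigma> t) $$ (p, l) * X t $ l\<bar>)"
        using row_upper_triangular_scalar_prod[OF sysD(1) Xc p np zero[OF signalsD[OF \<sigma>]]]
        by simp
      also have "\<dots> \<le> (\<Sum>l\<in>{p<..<n}. a * \<bar>X t $ l\<bar>)"
        unfolding abs_mult using a[OF signalsD[OF \<sigma>] pn] by (intro sum_mono mult_right_mono) auto
      finally have Ax: "\<bar>row (A (\<sigma> t)) p \<bullet> X t\<bar> \<le> a * (\<Sum>l\<in>{p<..<n}. \<bar>X t $ l\<bar>)"
        by (simp add: sum_distrib_left)
      have "X (Suc t) $ p = row (A (\<sigma> t)) p \<bullet> X t + (B (\<sigma> t) *\<^sub>v ?u) $ p"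
        unfolding X_Suc using sysD[of t] pn by simp
      then show "\<bar>X (Suc t) $ p\<bar> \<le> b * \<rho> ^ t * N + a * (\<Sum>l\<in>{p<..<n}. \<bar>X t $ l\<bar>)"
        using Ax Bu by linarith
    qed
    have "cascade \<rho> a b np n (\<lambda>t l. X t $ l) N" unfolding cascade_def using N 1 2 3 by blast
    then have "\<bar>X t $ l\<bar> \<le> E * \<rho> ^ t * N" if "l < n" for l using E_bound that by blast
    then have "euclid_norm (X t) \<le> real n * (E * \<rho> ^ t * N)"
      by (rule euclid_norm_le_dim_mult[OF Xc])
    also have "\<dots> = (real n * E) * (\<rho> ^ t * N)" by (simp add: mult_ac)
    also have "\<dots> \<le> (1 + real n * E) * (\<rho> ^ t * N)" using pos by (intro mult_right_mono) auto
    finally show ?thesis by (simp add: N_def mult.assoc)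
  qed
  moreover have "1 + real n * E > 0" using E by (simp add: add_pos_nonneg)
  ultimately show ?thesis using \<chi> \<rho> unfolding attainable_rate_def by (meson less_imp_le)
qed

subsection \<open>Change of coordinates and feedback\<close>

lemma vec_diff_diff:
  fixes a b c :: "'a :: ab_group_add vec"
  assumes "a \<in> carrier_vec m" "b \<in> carrier_vec m" "c \<in> carrier_vec m"
  shows "a - b - c = a - (b + c)"
  using assms by (intro eq_vecI) auto

lemma vec_diff_uminus_diff:
  fixes a b :: "'a :: ab_group_add vec"
  assumes "a \<in> carrier_vec m" "b \<in> carrier_vec m"
  shows "a - - b - b = a"
  using assms by (intro eq_vecI) auto

lemma vec_add_diff_cancel_left:
  fixes a b :: "'a :: ab_group_add vec"
  assumes "a \<in> carrier_vec m" "b \<in> carrier_vec m"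
  shows "a + b - a = b"
  using assms by (intro eq_vecI) auto

lemma vec_add_add_diff:
  fixes a b c :: "'a :: ab_group_add vec"
  assumes "a \<in> carrier_vec n" "b \<in> carrier_vec n" "c \<in> carrier_vec n"
  shows "(a + b) + (c - b) = a + c"
  using assms by (intro eq_vecI) auto

lemma mat_index_eq_mult_unit_vec:
  fixes A :: "'a :: semiring_1 mat"
  assumes "A \<in> carrier_mat nr nc" "i < nr" "j < nc"
  shows "A $$ (i, j) = (A *\<^sub>v unit_vec nc j) $ i"
  using assms by (simp add: row_def)

lemma eq_mat_if_mult_vec_eq:
  fixes A B :: "'a :: semiring_1 mat"
  assumes A: "A \<in> carrier_mat nr nc" and B: "B \<in> carrier_mat nr nc"
    and "\<And>x. x \<in> carrier_vec nc \<Longrightarrow> A *\<^sub>v x = B *\<^sub>v x"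
  shows "A = B"
proof (rule eq_matI)
  fix i j assume "i < dim_row B" "j < dim_col B"
  then have ij: "i < nr" "j < nc" using B by auto
  show "A $$ (i, j) = B $$ (i, j)"
    unfolding mat_index_eq_mult_unit_vec[OF A ij] mat_index_eq_mult_unit_vec[OF B ij]
      assms(3)[OF unit_vec_carrier] ..
qed (use A B in auto)

text \<open>\<open>Q\<close> is an explicit inverse of \<open>P\<close>. Stating the change as a
  vector identity for all states and inputs makes it easy to compose and invert, and matches the
  hypothesis \<open>step\<close> of \<open>attainable_rate_factor\<close>.\<close>

definition feedback_equivalent ::
    "feedback_kind \<Rightarrow> nat \<Rightarrow> nat \<Rightarrow> nat \<Rightarrow> (nat \<Rightarrow> real mat) \<Rightarrow> (nat \<Rightarrow> real mat) \<Rightarrow>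
     real mat \<Rightarrow> real mat \<Rightarrow> (nat \<Rightarrow> real mat) \<Rightarrow> (nat \<Rightarrow> real mat) \<Rightarrow> (nat \<Rightarrow> real mat) \<Rightarrow> bool" where
  "feedback_equivalent k M n m A B P Q K A' B' \<longleftrightarrow>
     P \<in> carrier_mat n n \<and> Q \<in> carrier_mat n n \<and>
     (\<forall>x\<in>carrier_vec n. P *\<^sub>v (Q *\<^sub>v x) = x \<and> Q *\<^sub>v (P *\<^sub>v x) = x) \<and>
     (\<forall>j\<in>{1..M}. K j \<in> carrier_mat m n) \<and> admissible_family k M K \<and>
     switched_system M n m A' B' \<and>
     (\<forall>j\<in>{1..M}. \<forall>x\<in>carrier_vec n. \<forall>u\<in>carrier_vec m.
        P *\<^sub>v (A j *\<^sub>v x + B j *\<^sub>v u) = A' j *\<^sub>v (P *\<^sub>v x) + B' j *\<^sub>v (u - K j *\<^sub>v x))"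

lemma feedback_equivalentD:
  assumes "feedback_equivalent k M n m A B P Q K A' B'"
  shows "P \<in> carrier_mat n n" "Q \<in> carrier_mat n n"
    "\<And>x. x \<in> carrier_vec n \<Longrightarrow> P *\<^sub>v (Q *\<^sub>v x) = x"
    "\<And>x. x \<in> carrier_vec n \<Longrightarrow> Q *\<^sub>v (P *\<^sub>v x) = x"
    "\<And>j. j \<in> {1..M} \<Longrightarrow> K j \<in> carrier_mat m n" "admissible_family k M K"
    "switched_system M n m A' B'"
    "\<And>j x u. j \<in> {1..M} \<Longrightarrow> x \<in> carrier_vec n \<Longrightarrow> u \<in> carrier_vec m \<Longrightarrow>
        P *\<^sub>v (A j *\<^sub>v x + B j *\<^sub>v u) = A' j *\<^sub>v (P *\<^sub>v x) + B' j *\<^sub>v (u - K j *\<^sub>v x)"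
  using assms unfolding feedback_equivalent_def by blast+

lemma feedback_equivalent_refl:
  assumes "switched_system M n m A B"
  shows "feedback_equivalent k M n m A B (1\<^sub>m n) (1\<^sub>m n) (\<lambda>_. 0\<^sub>m m n) A B"
proof -
  have "1\<^sub>m n *\<^sub>v (A j *\<^sub>v x + B j *\<^sub>v u) = A j *\<^sub>v (1\<^sub>m n *\<^sub>v x) + B j *\<^sub>v (u - 0\<^sub>m m n *\<^sub>v x)"
    if j: "j \<in> {1..M}" and x: "x \<in> carrier_vec n" and u: "u \<in> carrier_vec m" for j x u
  proof -
    note AB = switched_systemD[OF assms j]
    have "A j *\<^sub>v x + B j *\<^sub>v u \<in> carrier_vec n"
      using AB x u by (meson add_carrier_vec mult_mat_vec_carrier)
    moreover have "u - 0\<^sub>m m n *\<^sub>v x = u" using x u by (intro eq_vecI) auto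
    ultimately show ?thesis using x by simp
  qed
  then show ?thesis using assms unfolding feedback_equivalent_def by auto
qed

text \<open>The second gain acts on the state in the intermediate coordinates, whence the factor
  \<open>P\<^sub>1\<close> in the composed gain.\<close>

lemma feedback_equivalent_trans:
  assumes sys: "switched_system M n m A B"
    and 1: "feedback_equivalent k M n m A B P\<^sub>1 Q\<^sub>1 K\<^sub>1 A' B'"
    and 2: "feedback_equivalent k M n m A' B' P\<^sub>2 Q\<^sub>2 K\<^sub>2 A'' B''"
  shows "feedback_equivalent k M n m A B (P\<^sub>2 * P\<^sub>1) (Q\<^sub>1 * Q\<^sub>2) (\<lambda>j. K\<^sub>1 j + K\<^sub>2 j * P\<^sub>1) A'' B''"
proof -
  note D1 = feedback_equivalentD[OF 1] and D2 = feedback_equivalentD[OF 2]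
  have "P\<^sub>2 * P\<^sub>1 *\<^sub>v (Q\<^sub>1 * Q\<^sub>2 *\<^sub>v x) = x" "Q\<^sub>1 * Q\<^sub>2 *\<^sub>v (P\<^sub>2 * P\<^sub>1 *\<^sub>v x) = x" if x: "x \<in> carrier_vec n" for x
  proof -
    have c: "Q\<^sub>2 *\<^sub>v x \<in> carrier_vec n" "P\<^sub>1 *\<^sub>v x \<in> carrier_vec n"
      using x D1(1) D2(2) by (meson mult_mat_vec_carrier)+
    have c': "Q\<^sub>1 *\<^sub>v (Q\<^sub>2 *\<^sub>v x) \<in> carrier_vec n" "P\<^sub>2 *\<^sub>v (P\<^sub>1 *\<^sub>v x) \<in> carrier_vec n"
      using c D1(2) D2(1) by (meson mult_mat_vec_carrier)+
    have "Q\<^sub>1 * Q\<^sub>2 *\<^sub>v x = Q\<^sub>1 *\<^sub>v (Q\<^sub>2 *\<^sub>v x)" "P\<^sub>2 * P\<^sub>1 *\<^sub>v x = P\<^sub>2 *\<^sub>v (P\<^sub>1 *\<^sub>v x)"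
      using assoc_mult_mat_vec[OF D1(2) D2(2) x] assoc_mult_mat_vec[OF D2(1) D1(1) x] .
    then show "P\<^sub>2 * P\<^sub>1 *\<^sub>v (Q\<^sub>1 * Q\<^sub>2 *\<^sub>v x) = x" "Q\<^sub>1 * Q\<^sub>2 *\<^sub>v (P\<^sub>2 * P\<^sub>1 *\<^sub>v x) = x"
      using assoc_mult_mat_vec[OF D2(1) D1(1) c'(1)] assoc_mult_mat_vec[OF D1(2) D2(2) c'(2)]
        D1(3)[OF c(1)] D2(3)[OF x] D2(4)[OF c(2)] D1(4)[OF x] by simp_all
  qed
  moreover have "K\<^sub>1 j + K\<^sub>2 j * P\<^sub>1 \<in> carrier_mat m n" if "j \<in> {1..M}" for j
    using D1(5)[OF that] D2(5)[OF that] D1(1) by auto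
  moreover have "admissible_family k M (\<lambda>j. K\<^sub>1 j + K\<^sub>2 j * P\<^sub>1)"
    using admissible_family_map2[OF D1(6) D2(6), of "\<lambda>X Y. X + Y * P\<^sub>1"] .
  moreover have "P\<^sub>2 * P\<^sub>1 *\<^sub>v (A j *\<^sub>v x + B j *\<^sub>v u) =
      A'' j *\<^sub>v (P\<^sub>2 * P\<^sub>1 *\<^sub>v x) + B'' j *\<^sub>v (u - (K\<^sub>1 j + K\<^sub>2 j * P\<^sub>1) *\<^sub>v x)"
    if j: "j \<in> {1..M}" and x: "x \<in> carrier_vec n" and u: "u \<in> carrier_vec m" for j x u
  proof -
    note AB = switched_systemD[OF sys j]
    have v: "A j *\<^sub>v x + B j *\<^sub>v u \<in> carrier_vec n"
      using AB x u by (meson add_carrier_vec mult_mat_vec_carrier)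
    have P1x: "P\<^sub>1 *\<^sub>v x \<in> carrier_vec n" using x D1(1) by (meson mult_mat_vec_carrier)
    have Kx: "K\<^sub>1 j *\<^sub>v x \<in> carrier_vec m" "K\<^sub>2 j *\<^sub>v (P\<^sub>1 *\<^sub>v x) \<in> carrier_vec m"
      using x P1x D1(5)[OF j] D2(5)[OF j] by (meson mult_mat_vec_carrier)+
    have K2P: "K\<^sub>2 j * P\<^sub>1 \<in> carrier_mat m n" using D2(5)[OF j] D1(1) by auto
    have "P\<^sub>2 * P\<^sub>1 *\<^sub>v (A j *\<^sub>v x + B j *\<^sub>v u) = P\<^sub>2 *\<^sub>v (P\<^sub>1 *\<^sub>v (A j *\<^sub>v x + B j *\<^sub>v u))"
      using assoc_mult_mat_vec[OF D2(1) D1(1) v] .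
    also have "\<dots> = A'' j *\<^sub>v (P\<^sub>2 *\<^sub>v (P\<^sub>1 *\<^sub>v x)) + B'' j *\<^sub>v ((u - K\<^sub>1 j *\<^sub>v x) - K\<^sub>2 j *\<^sub>v (P\<^sub>1 *\<^sub>v x))"
      unfolding D1(8)[OF j x u] using D2(8)[OF j P1x] u Kx by simp
    also have "(u - K\<^sub>1 j *\<^sub>v x) - K\<^sub>2 j *\<^sub>v (P\<^sub>1 *\<^sub>v x) = u - (K\<^sub>1 j + K\<^sub>2 j * P\<^sub>1) *\<^sub>v x"
      unfolding add_mult_distrib_mat_vec[OF D1(5)[OF j] K2P x]
        assoc_mult_mat_vec[OF D2(5)[OF j] D1(1) x]
      using vec_diff_diff[OF u Kx] .
    also have "P\<^sub>2 *\<^sub>v (P\<^sub>1 *\<^sub>v x) = P\<^sub>2 * P\<^sub>1 *\<^sub>v x" using assoc_mult_mat_vec[OF D2(1) D1(1) x] by simp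
    finally show ?thesis .
  qed
  ultimately show ?thesis
    using D1(1,2) D2(1,2,7) unfolding feedback_equivalent_def by auto
qed

text \<open>Solving \<open>v = u - K x\<close> with \<open>x = Q z\<close> for the old input gives
  \<open>u = v - (- K Q) z\<close>, which explains the gain.\<close>

lemma feedback_equivalent_sym:
  assumes sys: "switched_system M n m A B"
    and eq: "feedback_equivalent k M n m A B P Q K A' B'"
  shows "feedback_equivalent k M n m A' B' Q P (\<lambda>j. - (K j * Q)) A B"
proof -
  note D = feedback_equivalentD[OF eq]
  have "Q *\<^sub>v (A' j *\<^sub>v z + B' j *\<^sub>v v) = A j *\<^sub>v (Q *\<^sub>v z) + B j *\<^sub>v (v - - (K j * Q) *\<^sub>v z)"
    if j: "j \<in> {1..M}" and z: "z \<in> carrier_vec n" and v: "v \<in> carrier_vec m" for j z v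
  proof -
    define x where "x = Q *\<^sub>v z"
    have x: "x \<in> carrier_vec n" "P *\<^sub>v x = z"
      unfolding x_def using z D(2,3) by (auto intro: mult_mat_vec_carrier)
    have Kx: "K j *\<^sub>v x \<in> carrier_vec m" using D(5)[OF j] x by (meson mult_mat_vec_carrier)
    have KQ: "- (K j * Q) *\<^sub>v z = - (K j *\<^sub>v x)"
      using z D(2) D(5)[OF j] assoc_mult_mat_vec[OF D(5)[OF j] D(2) z] by (simp add: x_def)
    define u where "u = v - - (K j *\<^sub>v x)"
    have u: "u \<in> carrier_vec m" "u - K j *\<^sub>v x = v"
      using v Kx vec_diff_uminus_diff[OF v Kx] unfolding u_def by auto
    have c: "A j *\<^sub>v x + B j *\<^sub>v u \<in> carrier_vec n"
      using switched_systemD[OF sys j] x u by (meson add_carrier_vec mult_mat_vec_carrier)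
    have "A' j *\<^sub>v z + B' j *\<^sub>v v = P *\<^sub>v (A j *\<^sub>v x + B j *\<^sub>v u)"
      using D(8)[OF j x(1) u(1)] x u by simp
    then show ?thesis using D(4)[OF c] unfolding KQ u_def[symmetric] x_def[symmetric] by simp
  qed
  moreover have "admissible_family k M (\<lambda>j. - (K j * Q))"
    using admissible_family_map[OF D(6), of "\<lambda>X. - (X * Q)"] .
  moreover have "- (K j * Q) \<in> carrier_mat m n" if "j \<in> {1..M}" for j
    using D(2) D(5)[OF that] by auto
  ultimately show ?thesis using sys D(1-4) unfolding feedback_equivalent_def by blast
qed

text \<open>This is the factor argument with \<open>P\<close> as the factor map, whose fibres are
  single points. The gap between \<rho> and \<rho>' is inherited from there.\<close>

lemma feedback_equivalent_attainable_rate: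
  assumes sys: "switched_system M n m A B"
    and eq: "feedback_equivalent k M n m A B P Q K A' B'"
    and att: "attainable_rate k M n m A B \<rho>" "\<rho> < \<rho>'"
  shows "attainable_rate k M n m A' B' \<rho>'"
proof -
  note D = feedback_equivalentD[OF eq]
  obtain c where c: "c > 0"
    "\<And>x. x \<in> carrier_vec n \<Longrightarrow> euclid_norm (P *\<^sub>v x) \<le> c * euclid_norm x"
    using euclid_norm_mult_mat_vec_bound[of P] D(1) by auto
  obtain d where d: "d > 0"
    "\<And>x. x \<in> carrier_vec n \<Longrightarrow> euclid_norm (Q *\<^sub>v x) \<le> d * euclid_norm x"
    using euclid_norm_mult_mat_vec_bound[of Q] D(2) by auto
  have "Q *\<^sub>v x \<in> carrier_vec n \<and> P *\<^sub>v (Q *\<^sub>v x) = x" "P *\<^sub>v x \<in> carrier_vec n"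
    if "x \<in> carrier_vec n" for x
    using that D(1,2,3) by (auto intro: mult_mat_vec_carrier)
  from attainable_rate_factor[OF sys D(7) D(5,6) this(2) c(2,1) this(1) d(2,1) D(8) att]
  show ?thesis .
qed

text \<open>The pointwise identity is applied with input \<open>K x + v\<close>; injectivity of
  \<open>P\<close> carries the equation back to the old coordinates.\<close>

lemma feedback_equivalent_admits_representation:
  assumes sys: "switched_system M n m A B"
    and eq: "feedback_equivalent k M n m A B P Q K A' B'"
  shows "admits_representation M n m A B P K A' B'"
  unfolding admits_representation_def
proof (intro ballI allI impI)
  fix \<sigma> and x v :: "nat \<Rightarrow> real vec"
  assume \<sigma>: "\<sigma> \<in> signals M" and xv: "\<forall>t. x t \<in> carrier_vec n \<and> v t \<in> carrier_vec m"
  note D = feedback_equivalentD[OF eq] and \<sigma>t = signalsD[OF \<sigma>]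
  define u where "u = (\<lambda>t. K (\<sigma> t) *\<^sub>v x t + v t)"
  have Kx: "K (\<sigma> t) *\<^sub>v x t \<in> carrier_vec m" for t
    using D(5)[OF \<sigma>t] xv by (meson mult_mat_vec_carrier)
  have u: "u t \<in> carrier_vec m" "u t - K (\<sigma> t) *\<^sub>v x t = v t" for t
    using xv Kx[of t] vec_add_diff_cancel_left[OF Kx] unfolding u_def by auto
  have Px: "P *\<^sub>v x t \<in> carrier_vec n" for t using xv D(1) by (meson mult_mat_vec_carrier)
  have "x (Suc t) = A (\<sigma> t) *\<^sub>v x t + B (\<sigma> t) *\<^sub>v u t \<longleftrightarrow>
      P *\<^sub>v x (Suc t) = A' (\<sigma> t) *\<^sub>v (P *\<^sub>v x t) + B' (\<sigma> t) *\<^sub>v v t" for t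
  proof -
    have c: "A (\<sigma> t) *\<^sub>v x t + B (\<sigma> t) *\<^sub>v u t \<in> carrier_vec n"
      using switched_systemD[OF sys \<sigma>t] xv u by (meson add_carrier_vec mult_mat_vec_carrier)
    have "P *\<^sub>v (A (\<sigma> t) *\<^sub>v x t + B (\<sigma> t) *\<^sub>v u t) =
        A' (\<sigma> t) *\<^sub>v (P *\<^sub>v x t) + B' (\<sigma> t) *\<^sub>v v t"
      using D(8)[OF \<sigma>t] xv u by simp
    then show ?thesis using D(4)[OF c] D(4)[of "x (Suc t)"] xv by metis
  qed
  then show "trajectory n m A B \<sigma> x (\<lambda>t. K (\<sigma> t) *\<^sub>v x t + v t) \<longleftrightarrow>
      trajectory n m A' B' \<sigma> (\<lambda>t. P *\<^sub>v x t) v"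
    unfolding trajectory_def u_def[symmetric] using xv u Px
    by (simp add: u_def[symmetric, THEN fun_cong])
qed

lemma feedback_equivalent_invertible_mat:
  assumes "feedback_equivalent k M n m A B P Q K A' B'"
  shows "invertible_mat P"
proof -
  note D = feedback_equivalentD[OF assms]
  have "P * Q = 1\<^sub>m n" "Q * P = 1\<^sub>m n"
    using D(1-4) assoc_mult_mat_vec[OF D(1,2)] assoc_mult_mat_vec[OF D(2,1)]
    by (auto intro!: eq_mat_if_mult_vec_eq[of _ n n])
  then show ?thesis
    using D(1,2) unfolding invertible_mat_def inverts_mat_def by (auto intro!: exI[of _ Q])
qed

section \<open>Rank-one updates I + c d r^T of the identity\<close>

definition rank_one_update :: "nat \<Rightarrow> real \<Rightarrow> real vec \<Rightarrow> real vec \<Rightarrow> real mat" where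
  "rank_one_update n c d r = mat n n (\<lambda>(i, j). (if i = j then 1 else 0) + c * d $ i * r $ j)"

lemma rank_one_update_carrier [simp]: "rank_one_update n c d r \<in> carrier_mat n n"
  by (simp add: rank_one_update_def)

lemma rank_one_update_mult_vec:
  assumes "r \<in> carrier_vec n" "d \<in> carrier_vec n" "z \<in> carrier_vec n"
  shows "rank_one_update n c d r *\<^sub>v z = z + (c * (r \<bullet> z)) \<cdot>\<^sub>v d"
proof (rule eq_vecI)
  fix i assume "i < dim_vec (z + (c * (r \<bullet> z)) \<cdot>\<^sub>v d)"
  then have i: "i < n" using assms by simp
  have unit: "(\<Sum>l\<in>{0..<n}. (if i = l then 1 else 0) * z $ l) = z $ i"
    using i by (subst sum.cong[OF refl, of _ _ "\<lambda>l. if i = l then z $ l else 0"]) auto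
  have "(rank_one_update n c d r *\<^sub>v z) $ i =
      (\<Sum>l\<in>{0..<n}. ((if i = l then 1 else 0) + c * d $ i * r $ l) * z $ l)"
    using i assms by (simp add: rank_one_update_def scalar_prod_def)
  also have "\<dots> = (\<Sum>l\<in>{0..<n}. (if i = l then 1 else 0) * z $ l) + c * d $ i * (r \<bullet> z)"
    using assms unfolding scalar_prod_def sum_distrib_left sum.distrib[symmetric]
    by (auto intro!: sum.cong simp: algebra_simps)
  also have "\<dots> = z $ i + c * (r \<bullet> z) * d $ i" unfolding unit by simp
  finally show "(rank_one_update n c d r *\<^sub>v z) $ i = (z + (c * (r \<bullet> z)) \<cdot>\<^sub>v d) $ i"
    using i assms by simp
qed (use assms in \<open>simp add: rank_one_update_def\<close>)

text \<open>The product of I + e d r^T and I + c d r^T is I + (e + c + e c (r \<bullet> d)) d r^T,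
  as in the Sherman-Morrison formula.\<close>

lemma rank_one_update_inverse:
  assumes r: "r \<in> carrier_vec n" and d: "d \<in> carrier_vec n" and z: "z \<in> carrier_vec n"
    and e: "e + c + e * c * (r \<bullet> d) = 0"
  shows "rank_one_update n e d r *\<^sub>v (rank_one_update n c d r *\<^sub>v z) = z"
proof -
  have cd: "(c * (r \<bullet> z)) \<cdot>\<^sub>v d \<in> carrier_vec n" using d by simp
  have "r \<bullet> (z + (c * (r \<bullet> z)) \<cdot>\<^sub>v d) = r \<bullet> z + c * (r \<bullet> z) * (r \<bullet> d)"
    using r d z by (simp add: scalar_prod_add_distrib[OF r z cd])
  then have "c * (r \<bullet> z) + e * (r \<bullet> (z + (c * (r \<bullet> z)) \<cdot>\<^sub>v d)) = (e + c + e * c * (r \<bullet> d)) * (r \<bullet> z)"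
    by (simp add: algebra_simps)
  then have coeff: "c * (r \<bullet> z) + e * (r \<bullet> (z + (c * (r \<bullet> z)) \<cdot>\<^sub>v d)) = 0" unfolding e by simp
  have "rank_one_update n e d r *\<^sub>v (rank_one_update n c d r *\<^sub>v z) =
      (z + (c * (r \<bullet> z)) \<cdot>\<^sub>v d) + (e * (r \<bullet> (z + (c * (r \<bullet> z)) \<cdot>\<^sub>v d))) \<cdot>\<^sub>v d"
    using rank_one_update_mult_vec[OF r d z, of c] rank_one_update_mult_vec[OF r d, of _ e] z cd
    by simp
  also have "\<dots> = z + (c * (r \<bullet> z) + e * (r \<bullet> (z + (c * (r \<bullet> z)) \<cdot>\<^sub>v d))) \<cdot>\<^sub>v d"
    using z d by (intro eq_vecI) (auto simp: distrib_right)
  also have "\<dots> = z" unfolding coeff using z d by (intro eq_vecI) auto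
  finally show ?thesis .
qed

subsection \<open>Splitting off null states\<close>

text \<open>Including the diagonal makes the leading block strictly upper triangular, and letting
  \<open>a\<close> run up to \<open>n\<close> makes the block below it zero, so one predicate yields
  both nilpotency and the block form.\<close>

definition triangular_upto :: "nat \<Rightarrow> nat \<Rightarrow> nat \<Rightarrow> (nat \<Rightarrow> real mat) \<Rightarrow> bool" where
  "triangular_upto M n k A \<longleftrightarrow>
     (\<forall>j\<in>{1..M}. \<forall>b<k. \<forall>a. b \<le> a \<longrightarrow> a < n \<longrightarrow> A j $$ (a, b) = 0)"

text \<open>If coordinate \<open>q\<close> of \<open>x\<close> is non-zero, its coordinate
  functional serves; otherwise adding the one for \<open>p\<close> gives the value
  \<open>x $ p\<close>.\<close>

lemma separating_functional:
  assumes x: "x \<in> carrier_vec n" and q: "q < n" and p: "q \<le> p" "p < n" "x $ p \<noteq> (0 :: real)"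
  obtains r where "r \<in> carrier_vec n" "\<And>b. b < q \<Longrightarrow> r $ b = 0" "r $ q = 1" "r \<bullet> x \<noteq> 0"
proof (cases "x $ q = 0")
  case False
  show ?thesis
    by (rule that[of "unit_vec n q"]) (use False x q in \<open>auto simp: scalar_prod_left_unit\<close>)
next
  case True
  then have "p \<noteq> q" using p by auto
  moreover have "(unit_vec n q + unit_vec n p) \<bullet> x = x $ p"
    using x q p True by (subst add_scalar_prod_distrib[of _ n]) (auto simp: scalar_prod_left_unit)
  ultimately show ?thesis
    by (intro that[of "unit_vec n q + unit_vec n p"]) (use p q in auto)
qed

text \<open>With \<open>r\<close> vanishing on the first \<open>q\<close> basis vectors and \<open>r\<^sub>q = 1\<close>, the matrix
  \<open>I + (x - e\<^sub>q) r\<^sup>T\<close> fixes those vectors and maps \<open>e\<^sub>q\<close> to \<open>x\<close>; the gain \<open>w r\<^sup>T / (r \<bullet> x)\<close> applies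
  the input \<open>w\<close> at \<open>x\<close> and no input on them.\<close>

lemma feedback_equivalent_extend:
  assumes sys: "switched_system M n m A B" and q: "q < n" and tri: "triangular_upto M n q A"
    and x: "x \<in> carrier_vec n" and p: "q \<le> p" "p < n" "x $ p \<noteq> 0"
    and w: "\<And>j. j \<in> {1..M} \<Longrightarrow> w j \<in> carrier_vec m" "admissible_family k M w"
    and null: "\<And>j a. j \<in> {1..M} \<Longrightarrow> q \<le> a \<Longrightarrow> a < n \<Longrightarrow> (A j *\<^sub>v x + B j *\<^sub>v w j) $ a = 0"
  shows "\<exists>P Q K A' B'. feedback_equivalent k M n m A B P Q K A' B' \<and> triangular_upto M n (Suc q) A'"
proof -
  obtain r where r: "r \<in> carrier_vec n" "\<And>b. b < q \<Longrightarrow> r $ b = 0" "r $ q = 1" "r \<bullet> x \<noteq> 0"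
    using separating_functional[OF x q p] by blast
  define d where "d = x - unit_vec n q"
  have d: "d \<in> carrier_vec n" using x by (simp add: d_def)
  have rd: "r \<bullet> d = r \<bullet> x - 1"
    using r x q by (simp add: d_def scalar_prod_minus_distrib[of _ n])
  \<comment> \<open>With \<open>r \<bullet> d = r \<bullet> x - 1\<close>, the inverse of the update
    with coefficient 1 has the coefficient e solving 1 + e (r \<bullet> x) = 0.\<close>
  define P where "P = rank_one_update n (- 1 / (r \<bullet> x)) d r"
  define Q where "Q = rank_one_update n 1 d r"
  have car: "P \<in> carrier_mat n n" "Q \<in> carrier_mat n n" by (simp_all add: P_def Q_def)
  have PQ: "P *\<^sub>v (Q *\<^sub>v z) = z" "Q *\<^sub>v (P *\<^sub>v z) = z" if "z \<in> carrier_vec n" for z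
    unfolding P_def Q_def using that r d
    by (auto intro!: rank_one_update_inverse simp: rd field_simps)
  define K where "K = (\<lambda>j. mat m n (\<lambda>(i, l). w j $ i * (r $ l / (r \<bullet> x))))"
  have Kc: "K j \<in> carrier_mat m n" for j by (simp add: K_def)
  have Kz: "K j *\<^sub>v z = ((r \<bullet> z) / (r \<bullet> x)) \<cdot>\<^sub>v w j" if "j \<in> {1..M}" "z \<in> carrier_vec n" for j z
  proof (rule eq_vecI)
    fix i assume "i < dim_vec (((r \<bullet> z) / (r \<bullet> x)) \<cdot>\<^sub>v w j)"
    then have i: "i < m" using w(1)[OF that(1)] by simp
    then have "(K j *\<^sub>v z) $ i = (\<Sum>l\<in>{0..<n}. w j $ i * (r $ l / (r \<bullet> x)) * z $ l)"
      using that(2) by (simp add: K_def scalar_prod_def)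
    also have "\<dots> = (\<Sum>l\<in>{0..<n}. r $ l * z $ l) / (r \<bullet> x) * w j $ i"
      unfolding sum_divide_distrib sum_distrib_right by (intro sum.cong) auto
    also have "(\<Sum>l\<in>{0..<n}. r $ l * z $ l) = r \<bullet> z" using that(2) by (simp add: scalar_prod_def)
    finally show "(K j *\<^sub>v z) $ i = (((r \<bullet> z) / (r \<bullet> x)) \<cdot>\<^sub>v w j) $ i"
      using i w(1)[OF that(1)] by simp
  qed (use w(1)[OF that(1)] in \<open>simp add: K_def\<close>)
  define A' where "A' = (\<lambda>j. P * (A j + B j * K j) * Q)"
  define B' where "B' = (\<lambda>j. P * B j)"
  have sysD: "A j \<in> carrier_mat n n" "B j \<in> carrier_mat n m" if "j \<in> {1..M}" for j
    using switched_systemD[OF sys that] .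
  have ABK: "A j + B j * K j \<in> carrier_mat n n" if "j \<in> {1..M}" for j
    using sysD[OF that] Kc by auto
  have A'z: "A' j *\<^sub>v z = P *\<^sub>v (A j *\<^sub>v (Q *\<^sub>v z) + B j *\<^sub>v (K j *\<^sub>v (Q *\<^sub>v z)))"
    if j: "j \<in> {1..M}" and z: "z \<in> carrier_vec n" for j z
  proof -
    have Qz: "Q *\<^sub>v z \<in> carrier_vec n" using car z by (meson mult_mat_vec_carrier)
    have BK: "B j * K j \<in> carrier_mat n n" using sysD[OF j] Kc by auto
    have "A' j *\<^sub>v z = P *\<^sub>v ((A j + B j * K j) *\<^sub>v (Q *\<^sub>v z))"
      unfolding A'_def using car ABK[OF j] z Qz
      by (simp add: assoc_mult_mat_vec[of _ n n _ n])
    then show ?thesis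
      unfolding add_mult_distrib_mat_vec[OF sysD(1)[OF j] BK Qz]
        assoc_mult_mat_vec[OF sysD(2)[OF j] Kc Qz] .
  qed
  have step: "P *\<^sub>v (A j *\<^sub>v z + B j *\<^sub>v u) = A' j *\<^sub>v (P *\<^sub>v z) + B' j *\<^sub>v (u - K j *\<^sub>v z)"
    if j: "j \<in> {1..M}" and z: "z \<in> carrier_vec n" and u: "u \<in> carrier_vec m" for j z u
  proof -
    have Kzc: "K j *\<^sub>v z \<in> carrier_vec m" using Kc z by (meson mult_mat_vec_carrier)
    have c: "A j *\<^sub>v z \<in> carrier_vec n" "B j *\<^sub>v (K j *\<^sub>v z) \<in> carrier_vec n"
      "B j *\<^sub>v u \<in> carrier_vec n" "P *\<^sub>v z \<in> carrier_vec n"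
      using sysD[OF j] car z Kzc u by (meson mult_mat_vec_carrier)+
    have "A' j *\<^sub>v (P *\<^sub>v z) + B' j *\<^sub>v (u - K j *\<^sub>v z) =
        P *\<^sub>v (A j *\<^sub>v z + B j *\<^sub>v (K j *\<^sub>v z)) + P *\<^sub>v (B j *\<^sub>v u - B j *\<^sub>v (K j *\<^sub>v z))"
      unfolding A'z[OF j c(4)] PQ(2)[OF z] B'_def
      using assoc_mult_mat_vec[OF car(1) sysD(2)[OF j], of "u - K j *\<^sub>v z"] u Kzc
        mult_minus_distrib_mat_vec[OF sysD(2)[OF j] u Kzc] by simp
    also have "\<dots> = P *\<^sub>v ((A j *\<^sub>v z + B j *\<^sub>v (K j *\<^sub>v z)) + (B j *\<^sub>v u - B j *\<^sub>v (K j *\<^sub>v z)))"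
      using c by (intro mult_add_distrib_mat_vec[OF car(1), symmetric]) auto
    also have "(A j *\<^sub>v z + B j *\<^sub>v (K j *\<^sub>v z)) + (B j *\<^sub>v u - B j *\<^sub>v (K j *\<^sub>v z)) = A j *\<^sub>v z + B j *\<^sub>v u"
      using vec_add_add_diff[OF c(1-3)] .
    finally show ?thesis ..
  qed
  have adm: "admissible_family k M K"
    unfolding K_def
    using admissible_family_map[OF w(2), of "\<lambda>v. mat m n (\<lambda>(i, l). v $ i * (r $ l / (r \<bullet> x)))"] .
  have "switched_system M n m A' B'"
    unfolding switched_system_def A'_def B'_def using car ABK sysD by auto
  then have equiv: "feedback_equivalent k M n m A B P Q K A' B'"
    unfolding feedback_equivalent_def using car PQ Kc adm step by blast
  \<comment> \<open>Vectors supported on the first \<open>q\<close> coordinates are annihilated by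
    \<open>r\<close>, hence untouched by the update.\<close>
  have P_fix: "P *\<^sub>v z = z" if z: "z \<in> carrier_vec n" and "\<And>a. q \<le> a \<Longrightarrow> a < n \<Longrightarrow> z $ a = 0" for z
  proof -
    have "r \<bullet> z = 0" unfolding scalar_prod_def
    proof (intro sum.neutral ballI)
      fix a assume "a \<in> {0..<dim_vec z}"
      then show "r $ a * z $ a = 0" using that(2)[of a] r(2)[of a] z by (cases "a < q") auto
    qed
    then show ?thesis unfolding P_def rank_one_update_mult_vec[OF r(1) d z]
      using z d by (intro eq_vecI) auto
  qed
  have "A' j $$ (a, b) = 0" if j: "j \<in> {1..M}" and b: "b < Suc q" and a: "b \<le> a" "a < n" for j a b
  proof -
    have bn: "b < n" using b q by simp
    have Qb: "Q *\<^sub>v unit_vec n b = unit_vec n b + (r $ b) \<cdot>\<^sub>v d"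
      unfolding Q_def rank_one_update_mult_vec[OF r(1) d unit_vec_carrier] using r(1) bn by simp
    have A'c: "A' j \<in> carrier_mat n n" unfolding A'_def using car ABK[OF j] by auto
    let ?f = "A j *\<^sub>v (Q *\<^sub>v unit_vec n b) + B j *\<^sub>v (K j *\<^sub>v (Q *\<^sub>v unit_vec n b))"
    have fc: "?f \<in> carrier_vec n"
      using sysD[OF j] car Kc unit_vec_carrier by (meson add_carrier_vec mult_mat_vec_carrier)
    \<comment> \<open>The first part lets \<open>P\<close> fix \<open>?f\<close>, the second then
      gives the zeros of column \<open>b\<close>. For \<open>b = q\<close> they come from the
      hypothesis on \<open>x\<close>, for smaller \<open>b\<close> from the triangularity already
      achieved.\<close>
    have f0: "(\<forall>a. q \<le> a \<longrightarrow> a < n \<longrightarrow> ?f $ a = 0) \<and> (\<forall>a. b \<le> a \<longrightarrow> a < n \<longrightarrow> ?f $ a = 0)"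
    proof (cases "b = q")
      case True
      have "Q *\<^sub>v unit_vec n b = x"
        unfolding Qb unfolding True r(3) d_def using x by (intro eq_vecI) auto
      moreover from this have "K j *\<^sub>v (Q *\<^sub>v unit_vec n b) = w j"
        using Kz[OF j x] r(4) by simp
      ultimately show ?thesis using null[OF j] True by simp
    next
      case False
      then have bq: "b < q" using b by simp
      have Qb': "Q *\<^sub>v unit_vec n b = unit_vec n b"
        unfolding Qb r(2)[OF bq] using d by (intro eq_vecI) auto
      have "?f = A j *\<^sub>v unit_vec n b"
        unfolding Qb' Kz[OF j unit_vec_carrier] using r(1) r(2)[OF bq] bn sysD[OF j] w(1)[OF j]
        by (intro eq_vecI) auto
      then have "?f $ a = 0" if "b \<le> a" "a < n" for a
        using tri j bq that mat_index_eq_mult_unit_vec[OF sysD(1)[OF j] that(2) bn]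
        unfolding triangular_upto_def by metis
      then show ?thesis using bq by simp
    qed
    have "A' j $$ (a, b) = (P *\<^sub>v ?f) $ a"
      unfolding mat_index_eq_mult_unit_vec[OF A'c a(2) bn] A'z[OF j unit_vec_carrier] ..
    also have "\<dots> = 0" using P_fix[OF fc] f0 a by simp
    finally show ?thesis .
  qed
  then have "triangular_upto M n (Suc q) A'" unfolding triangular_upto_def by blast
  then show ?thesis using equiv by blast
qed

text \<open>Every step, under any mode, annihilates one more coordinate from the bottom: at time
  \<open>t\<close> the coordinates from \<open>n - t\<close> on vanish, so time \<open>n\<close>
  suffices.\<close>

lemma triangular_fixed_time_stable:
  assumes A: "\<And>j. j \<in> {1..M} \<Longrightarrow> A j \<in> carrier_mat n n" and tri: "triangular_upto M n n A"
  shows "fixed_time_stable M n A"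
  unfolding fixed_time_stable_def
proof (intro exI[of _ n] ballI allI impI)
  fix \<sigma> y t
  assume \<sigma>: "\<sigma> \<in> signals M" and "\<forall>t. y t \<in> carrier_vec n \<and> y (Suc t) = A (\<sigma> t) *\<^sub>v y t"
    and t: "n \<le> t"
  then have yc: "y t \<in> carrier_vec n" and y_Suc: "y (Suc t) = A (\<sigma> t) *\<^sub>v y t" for t by blast+
  have zero: "y t $ i = 0" if "i < n" "n \<le> i + t" for i t
    using that
  proof (induction t arbitrary: i)
    case (Suc t)
    note At = A[OF signalsD[OF \<sigma>], of t]
    have "y (Suc t) $ i = (\<Sum>l\<in>{i<..<n}. A (\<sigma> t) $$ (i, l) * y t $ l)"
      unfolding y_Suc using row_upper_triangular_scalar_prod[OF At yc Suc.prems(1) order_refl, of t]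
        tri signalsD[OF \<sigma>, of t] At Suc.prems(1) unfolding triangular_upto_def by simp
    also have "\<dots> = 0" using Suc by (intro sum.neutral) auto
    finally show ?case .
  qed simp
  show "y t = 0\<^sub>v n" using yc[of t] zero t by (intro eq_vecI) auto
qed

text \<open>Admissibility is imposed on a family of input vectors at a fixed state: in the
  mode-independent case the same input must work under every mode.\<close>

definition no_state_steered_to_zero ::
    "feedback_kind \<Rightarrow> nat \<Rightarrow> nat \<Rightarrow> nat \<Rightarrow> (nat \<Rightarrow> real mat) \<Rightarrow> (nat \<Rightarrow> real mat) \<Rightarrow> bool" where
  "no_state_steered_to_zero k M n m A B \<longleftrightarrow>
     (\<forall>x\<in>carrier_vec n. \<forall>w. admissible_family k M w \<and> (\<forall>j\<in>{1..M}. w j \<in> carrier_vec m) \<and>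
        (\<forall>j\<in>{1..M}. A j *\<^sub>v x + B j *\<^sub>v w j = 0\<^sub>v n) \<longrightarrow> x = 0\<^sub>v n)"

text \<open>An adversary picks, at each non-zero state, a mode whose closed-loop step stays
  non-zero; the resulting signal defeats every time bound \<open>T\<close>.\<close>

lemma fixed_time_stabilizable_trivial:
  assumes sys: "switched_system M n m A B" and null: "no_state_steered_to_zero k M n m A B"
    and V: "V \<subseteq> carrier_vec n" and stab: "fixed_time_stabilizable k M n m A B V"
  shows "V \<subseteq> {0\<^sub>v n}"
proof
  fix x assume xV: "x \<in> V"
  from stab obtain \<phi> T where \<phi>: "\<phi> \<in> feedback_laws k M n m"
    and T: "\<And>\<sigma> x t. \<sigma> \<in> signals M \<Longrightarrow> closed_loop n m A B \<phi> \<sigma> x \<Longrightarrow> x 0 \<in> V \<Longrightarrow> t \<ge> T \<Longrightarrow> x t = 0\<^sub>v n"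
    unfolding fixed_time_stabilizable_def by blast
  have "\<exists>j\<in>{1..M}. A j *\<^sub>v y + B j *\<^sub>v \<phi> j y \<noteq> 0\<^sub>v n" if y: "y \<in> carrier_vec n" "y \<noteq> 0\<^sub>v n" for y
  proof -
    have "admissible_family k M \<phi>" using \<phi> by (simp add: feedback_laws_def)
    then have "admissible_family k M (\<lambda>j. \<phi> j y)" by (rule admissible_family_map)
    moreover have "\<forall>j\<in>{1..M}. \<phi> j y \<in> carrier_vec m" using feedback_lawsD[OF \<phi> _ y(1)] by blast
    ultimately show ?thesis using null y unfolding no_state_steered_to_zero_def by meson
  qed
  then obtain J where J: "\<And>y. y \<in> carrier_vec n \<Longrightarrow> y \<noteq> 0\<^sub>v n \<Longrightarrow> J y \<in> {1..M}"
    "\<And>y. y \<in> carrier_vec n \<Longrightarrow> y \<noteq> 0\<^sub>v n \<Longrightarrow> A (J y) *\<^sub>v y + B (J y) *\<^sub>v \<phi> (J y) y \<noteq> 0\<^sub>v n"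
    by metis
  show "x \<in> {0\<^sub>v n}"
  proof (rule ccontr)
    assume "x \<notin> {0\<^sub>v n}"
    then have x: "x \<in> carrier_vec n" "x \<noteq> 0\<^sub>v n" using xV V by auto
    \<comment> \<open>The mode depends on the current state, so the trajectory is built first and
      the signal is read off from it.\<close>
    define X where "X = rec_nat x (\<lambda>t y. A (J y) *\<^sub>v y + B (J y) *\<^sub>v \<phi> (J y) y)"
    have X_Suc: "X (Suc t) = A (J (X t)) *\<^sub>v X t + B (J (X t)) *\<^sub>v \<phi> (J (X t)) (X t)" for t
      by (simp add: X_def)
    have X: "X t \<in> carrier_vec n \<and> X t \<noteq> 0\<^sub>v n" for t
    proof (induction t)
      case 0
      then show ?case using x by (simp add: X_def)
    next
      case (Suc t)
      then have "J (X t) \<in> {1..M}" using J(1) by blast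
      then show ?case
        using switched_systemD[OF sys] feedback_lawsD[OF \<phi>] J(2) Suc unfolding X_Suc
        by (metis add_carrier_vec mult_mat_vec_carrier)
    qed
    define \<sigma> where "\<sigma> = (\<lambda>t. J (X t))"
    have \<sigma>: "\<sigma> \<in> signals M" unfolding signals_def \<sigma>_def using J(1) X by blast
    have "closed_loop n m A B \<phi> \<sigma> X"
      unfolding closed_loop_iff[OF \<phi> \<sigma>] using X X_Suc unfolding \<sigma>_def by blast
    then have "X T = 0\<^sub>v n" using T[OF \<sigma>, of X T] xV by (simp add: X_def)
    then show False using X by blast
  qed
qed

text \<open>The number \<open>q\<close> of triangular columns is taken maximal. A non-zero null
  state of the remaining block would allow \<open>feedback_equivalent_extend\<close> to produce one
  more column.\<close>

lemma exists_maximal_triangular_representation: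
  assumes sys: "switched_system M n m A B"
  obtains P Q K A' B' q where "q \<le> n" "feedback_equivalent k M n m A B P Q K A' B'"
    "triangular_upto M n q A'"
    "no_state_steered_to_zero k M (n - q) m (\<lambda>j. block_mat q q (n - q) (n - q) (A' j))
      (\<lambda>j. block_mat q 0 (n - q) m (B' j))"
proof -
  define rep where "rep = (\<lambda>q. q \<le> n \<and> (\<exists>P Q K A' B'.
    feedback_equivalent k M n m A B P Q K A' B' \<and> triangular_upto M n q A'))"
  have "rep 0"
    unfolding rep_def triangular_upto_def using feedback_equivalent_refl[OF sys] by blast
  moreover have bound: "\<forall>q. rep q \<longrightarrow> q \<le> n" by (simp add: rep_def)
  ultimately have "rep (GREATEST q. rep q)" using GreatestI_nat[of rep 0 n] by blast
  then obtain q where q: "rep q" "q = (GREATEST q. rep q)" by blast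
  have notSuc: "\<not> rep (Suc q)"
    using Greatest_le_nat[of rep "Suc q" n] bound q(2) by auto
  from q(1) obtain P Q K A' B' where qn: "q \<le> n"
    and eq: "feedback_equivalent k M n m A B P Q K A' B'" and tri: "triangular_upto M n q A'"
    unfolding rep_def by blast
  note sys' = feedback_equivalentD(7)[OF eq]
  have "y = 0\<^sub>v (n - q)" if y: "y \<in> carrier_vec (n - q)" and w: "admissible_family k M w"
    "\<And>j. j \<in> {1..M} \<Longrightarrow> w j \<in> carrier_vec m"
    and null: "\<And>j. j \<in> {1..M} \<Longrightarrow> block_mat q q (n - q) (n - q) (A' j) *\<^sub>v y +
        block_mat q 0 (n - q) m (B' j) *\<^sub>v w j = 0\<^sub>v (n - q)" for y w
  proof (rule ccontr)
    assume "y \<noteq> 0\<^sub>v (n - q)"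
    then obtain i where i: "i < n - q" "y $ i \<noteq> 0" using y by (metis carrier_vecD eq_vecI index_zero_vec)
    \<comment> \<open>The null state of the lower block is padded with zeros; its successors then
      vanish from coordinate \<open>q\<close> on, which is all the extension step asks for.\<close>
    define x where "x = vec n (\<lambda>l. if l < q then 0 else y $ (l - q))"
    have x: "x \<in> carrier_vec n" by (simp add: x_def)
    have tail: "tail_vec q x = y" using y qn by (intro eq_vecI) (auto simp: tail_vec_def x_def)
    have p: "q \<le> i + q" "i + q < n" "x $ (i + q) \<noteq> 0" using i by (auto simp: x_def)
    have "(A' j *\<^sub>v x + B' j *\<^sub>v w j) $ a = 0" if j: "j \<in> {1..M}" and a: "q \<le> a" "a < n" for j a
    proof -
      note AB = switched_systemD[OF sys' j]
      have c: "A' j *\<^sub>v x + B' j *\<^sub>v w j \<in> carrier_vec n"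
        using AB x w(2)[OF j] by (meson add_carrier_vec mult_mat_vec_carrier)
      have "tail_vec q (A' j *\<^sub>v x + B' j *\<^sub>v w j) = 0\<^sub>v (n - q)"
        using tail_vec_step[OF AB x w(2)[OF j] qn] tri j null[OF j]
        unfolding triangular_upto_def tail by simp
      then show ?thesis using tail_vec_index[OF c, of "a - q" q] a by simp
    qed
    moreover have "q < n" using i by simp
    ultimately obtain P\<^sub>2 Q\<^sub>2 K\<^sub>2 A'' B'' where eq2: "feedback_equivalent k M n m A' B' P\<^sub>2 Q\<^sub>2 K\<^sub>2 A'' B''"
      and "triangular_upto M n (Suc q) A''"
      using feedback_equivalent_extend[OF sys' _ tri x p w(2,1)] by blast
    then have "rep (Suc q)"
      unfolding rep_def using feedback_equivalent_trans[OF sys eq eq2] i by fastforce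
    then show False using notSuc by blast
  qed
  then have "no_state_steered_to_zero k M (n - q) m (\<lambda>j. block_mat q q (n - q) (n - q) (A' j))
      (\<lambda>j. block_mat q 0 (n - q) m (B' j))"
    unfolding no_state_steered_to_zero_def by blast
  then show ?thesis using that qn eq tri by blast
qed

text \<open>Rates of the lower block pass to the whole system by the cascade estimate; conversely,
  the lower block is a factor of the whole system under \<open>tail_vec q\<close>, with zero
  gain.\<close>

lemma minimal_growth_rate_lower_block:
  assumes sys: "switched_system M n m A B" and q: "q \<le> n" and tri: "triangular_upto M n q A"
  shows "minimal_growth_rate k M (n - q) m (\<lambda>j. block_mat q q (n - q) (n - q) (A j))
      (\<lambda>j. block_mat q 0 (n - q) m (B j)) = minimal_growth_rate k M n m A B"
    (is "minimal_growth_rate k M _ m ?A ?B = _")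
proof (rule minimal_growth_rate_eqI)
  fix \<rho> \<rho>' :: real
  assume att: "attainable_rate k M (n - q) m ?A ?B \<rho>" and less: "\<rho> < \<rho>'"
  \<comment> \<open>The strict inequality supplies the positive rate required by the cascade
    estimate, even when \<rho> is 0.\<close>
  then have "0 < \<rho>'" by (auto simp: attainable_rate_def)
  then show "attainable_rate k M n m A B \<rho>'"
    using attainable_rate_cascade[OF sys q _ attainable_rate_mono[OF att]] less tri
    unfolding triangular_upto_def by simp
next
  fix \<rho> \<rho>' :: real
  assume att: "attainable_rate k M n m A B \<rho>" and less: "\<rho> < \<rho>'"
  \<comment> \<open>Padding with zeros is a bounded section of \<open>tail_vec q\<close>.\<close>
  let ?r = "\<lambda>\<xi>. vec n (\<lambda>l. if l < q then 0 else \<xi> $ (l - q))"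
  have sys': "switched_system M (n - q) m ?A ?B" by (simp add: switched_system_def)
  have r: "?r \<xi> \<in> carrier_vec n \<and> tail_vec q (?r \<xi>) = \<xi>" if "\<xi> \<in> carrier_vec (n - q)" for \<xi> :: "real vec"
    using that q by (auto intro!: eq_vecI simp: tail_vec_def)
  have r_norm: "euclid_norm (?r \<xi>) \<le> (1 + real n) * euclid_norm \<xi>" if "\<xi> \<in> carrier_vec (n - q)" for \<xi>
  proof -
    have "euclid_norm (?r \<xi>) \<le> real n * euclid_norm \<xi>"
      using that euclid_norm_index_le[of _ \<xi>] by (intro euclid_norm_le_dim_mult) auto
    also have "\<dots> \<le> (1 + real n) * euclid_norm \<xi>" by (intro mult_right_mono) auto
    finally show ?thesis .
  qed
  have step: "tail_vec q (A j *\<^sub>v x + B j *\<^sub>v u) = ?A j *\<^sub>v tail_vec q x + ?B j *\<^sub>v (u - 0\<^sub>m m n *\<^sub>v x)"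
    if j: "j \<in> {1..M}" and x: "x \<in> carrier_vec n" and u: "u \<in> carrier_vec m" for j x u
  proof -
    have "u - 0\<^sub>m m n *\<^sub>v x = u" using x u by (intro eq_vecI) auto
    then show ?thesis
      using tail_vec_step[OF switched_systemD[OF sys j] x u q] tri j
      unfolding triangular_upto_def by simp
  qed
  show "attainable_rate k M (n - q) m ?A ?B \<rho>'"
    by (rule attainable_rate_factor[OF sys sys', of "\<lambda>_. 0\<^sub>m m n" _ "tail_vec q" "1 + real n" ?r
          "1 + real n", OF _ _ tail_vec_carrier euclid_norm_tail_vec _ r r_norm _ step att less])
      auto
qed

theorem theorem3:
  fixes M n m :: nat and A B :: "nat \<Rightarrow> real mat" and k :: feedback_kind
  assumes "switched_system M n m A B"
  shows "\<exists>P K np Ayy Ay\<xi> A\<xi>\<xi> By B\<xi>.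
    P \<in> carrier_mat n n \<and> invertible_mat P \<and>
    (\<forall>j\<in>{1..M}. K j \<in> carrier_mat m n) \<and> admissible_family k M K \<and>
    np \<le> n \<and>
    (\<forall>j\<in>{1..M}.
       Ayy j \<in> carrier_mat np np \<and> Ay\<xi> j \<in> carrier_mat np (n - np) \<and>
       A\<xi>\<xi> j \<in> carrier_mat (n - np) (n - np) \<and>
       By j \<in> carrier_mat np m \<and> B\<xi> j \<in> carrier_mat (n - np) m) \<and>
    admits_representation M n m A B P K
      (\<lambda>j. four_block_mat (Ayy j) (Ay\<xi> j) (0\<^sub>m (n - np) np) (A\<xi>\<xi> j))
      (\<lambda>j. By j @\<^sub>r B\<xi> j) \<and>
    fixed_time_stable M np Ayy \<and>
    (\<forall>V. subspace class_ring V (module_vec TYPE(real) (n - np)) \<and>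
         fixed_time_stabilizable k M (n - np) m A\<xi>\<xi> B\<xi> V \<longrightarrow> V = {0\<^sub>v (n - np)}) \<and>
    minimal_growth_rate k M (n - np) m A\<xi>\<xi> B\<xi> = minimal_growth_rate k M n m A B"
proof -
  obtain P Q K A' B' q where q: "q \<le> n"
    and eq: "feedback_equivalent k M n m A B P Q K A' B'" and tri: "triangular_upto M n q A'"
    and null: "no_state_steered_to_zero k M (n - q) m
      (\<lambda>j. block_mat q q (n - q) (n - q) (A' j)) (\<lambda>j. block_mat q 0 (n - q) m (B' j))"
    by (rule exists_maximal_triangular_representation[OF assms])
  note D = feedback_equivalentD[OF eq]
  define Ayy where "Ayy = (\<lambda>j. block_mat 0 0 q q (A' j))"
  define Ay\<xi> where "Ay\<xi> = (\<lambda>j. block_mat 0 q q (n - q) (A' j))"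
  define A\<xi>\<xi> where "A\<xi>\<xi> = (\<lambda>j. block_mat q q (n - q) (n - q) (A' j))"
  define By where "By = (\<lambda>j. block_mat 0 0 q m (B' j))"
  define B\<xi> where "B\<xi> = (\<lambda>j. block_mat q 0 (n - q) m (B' j))"
  note defs = Ayy_def Ay\<xi>_def A\<xi>\<xi>_def By_def B\<xi>_def
  have A'_eq: "four_block_mat (Ayy j) (Ay\<xi> j) (0\<^sub>m (n - q) q) (A\<xi>\<xi> j) = A' j"
    if j: "j \<in> {1..M}" for j
    using switched_systemD(1)[OF D(7) j] q tri j unfolding triangular_upto_def defs block_mat_def
    by (intro eq_matI) auto
  have B'_eq: "By j @\<^sub>r B\<xi> j = B' j" if j: "j \<in> {1..M}" for j
    using switched_systemD(2)[OF D(7) j] q unfolding append_rows_def defs block_mat_def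
    by (intro eq_matI) auto
  \<comment> \<open>The block expressions are known to agree with \<open>A'\<close> and
    \<open>B'\<close> only on the modes \<open>{1..M}\<close>, hence the restriction to
    signals.\<close>
  have "trajectory n m (\<lambda>j. four_block_mat (Ayy j) (Ay\<xi> j) (0\<^sub>m (n - q) q) (A\<xi>\<xi> j))
      (\<lambda>j. By j @\<^sub>r B\<xi> j) \<sigma> x v \<longleftrightarrow> trajectory n m A' B' \<sigma> x v" if "\<sigma> \<in> signals M" for \<sigma> x v
    unfolding trajectory_def A'_eq[OF signalsD[OF that]] B'_eq[OF signalsD[OF that]] ..
  then have rep: "admits_representation M n m A B P K
      (\<lambda>j. four_block_mat (Ayy j) (Ay\<xi> j) (0\<^sub>m (n - q) q) (A\<xi>\<xi> j)) (\<lambda>j. By j @\<^sub>r B\<xi> j)"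
    using feedback_equivalent_admits_representation[OF assms eq]
    unfolding admits_representation_def by simp
  have "triangular_upto M q q Ayy"
    using tri q unfolding triangular_upto_def Ayy_def block_mat_def by auto
  then have stable: "fixed_time_stable M q Ayy"
    by (rule triangular_fixed_time_stable[rotated]) (simp add: Ayy_def)
  have sys\<xi>: "switched_system M (n - q) m A\<xi>\<xi> B\<xi>" by (simp add: switched_system_def defs)
  have trivial: "V = {0\<^sub>v (n - q)}" if "subspace class_ring V (module_vec TYPE(real) (n - q))"
    "fixed_time_stabilizable k M (n - q) m A\<xi>\<xi> B\<xi> V" for V
  proof -
    \<comment> \<open>A subspace contains the zero vector, which turns the inclusion from
      \<open>fixed_time_stabilizable_trivial\<close> into an equality.\<close>
    interpret submodule class_ring V "module_vec TYPE(real) (n - q)"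
      using that(1) by (rule subspace.submod)
    have "V \<subseteq> carrier_vec (n - q)" "0\<^sub>v (n - q) \<in> V"
      using subset zero_closed by (simp_all add: module_vec_simps)
    then show ?thesis
      using fixed_time_stabilizable_trivial[OF sys\<xi> null[folded A\<xi>\<xi>_def B\<xi>_def] _ that(2)] by blast
  qed
  have "minimal_growth_rate k M (n - q) m A\<xi>\<xi> B\<xi> = minimal_growth_rate k M n m A' B'"
    unfolding A\<xi>\<xi>_def B\<xi>_def by (rule minimal_growth_rate_lower_block[OF D(7) q tri])
  \<comment> \<open>Rates pass in both directions because the inverse change is again a feedback
    equivalence.\<close>
  also have "\<dots> = minimal_growth_rate k M n m A B"
    by (rule minimal_growth_rate_eqI)
      (fact feedback_equivalent_attainable_rate[OF D(7) feedback_equivalent_sym[OF assms eq]]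
        feedback_equivalent_attainable_rate[OF assms eq])+
  finally have rate: "minimal_growth_rate k M (n - q) m A\<xi>\<xi> B\<xi> = minimal_growth_rate k M n m A B" .
  have "\<forall>j\<in>{1..M}. Ayy j \<in> carrier_mat q q \<and> Ay\<xi> j \<in> carrier_mat q (n - q) \<and>
       A\<xi>\<xi> j \<in> carrier_mat (n - q) (n - q) \<and> By j \<in> carrier_mat q m \<and> B\<xi> j \<in> carrier_mat (n - q) m"
    by (simp add: defs)
  moreover have "\<forall>j\<in>{1..M}. K j \<in> carrier_mat m n" using D(5) by blast
  moreover have "\<forall>V. subspace class_ring V (module_vec TYPE(real) (n - q)) \<and>
      fixed_time_stabilizable k M (n - q) m A\<xi>\<xi> B\<xi> V \<longrightarrow> V = {0\<^sub>v (n - q)}"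
    using trivial by blast
  ultimately show ?thesis
    using D(1,6) feedback_equivalent_invertible_mat[OF eq] q rep stable rate
    by - (rule exI[of _ P], rule exI[of _ K], rule exI[of _ q], rule exI[of _ Ayy],
        rule exI[of _ Ay\<xi>], rule exI[of _ A\<xi>\<xi>], rule exI[of _ By], rule exI[of _ B\<xi>], intro conjI)
qed

end
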